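(* For any $k > 1$, the square partition $(k, k, \ldots, k)$ of height $k$ and width $k$ is not the inertial partition of any graph $G$, and is not the Hermitian inertial partition of any graph $G$.
   Context: All graphs are finite, simple and undirected. For a graph $G=(V,E)$ with vertex set $V=\{1,\ldots,n\}$, $\mathcal{S}(G)$ (respectively $\mathcal{H}(G)$) is the set of all real symmetric (respectively complex Hermitian) $n\times n$ matrices $A=[a_{ij}]$ such that for $i\neq j$, $a_{ij}\neq 0$ if and only if $ij\in E$ (no condition on the diagonal entries). The partial inertia of a Hermitian matrix $A$ is $\operatorname{pin}(A)=(\pi(A),\nu(A))$, where $\pi(A)$ and $\nu(A)$ are the numbers of positive and of negative eigenvalues of $A$, counted with multiplicity. Define $\mathcal{I}(G)=\{\operatorname{pin}(A): A\in\mathcal{S}(G)\}$ and $\mathrm{h}\mathcal{I}(G)=\{\operatorname{pin}(A): A\in\mathcal{H}(G)\}$. For $j\in\{0,\ldots,n\}$ let $\pi_j(G)=\min\{r:(r,j)\in\mathcal{I}(G)\}$ and $\mathrm{h}\pi_j(G)=\min\{r:(r,j)\in\mathrm{h}\mathcal{I}(G)\}$. A partition is a finite weakly decreasing sequence of positive integers; its width is its first term and its height is the number of terms. With $m=\pi_0(G)$ and $h=\mathrm{h}\pi_0(G)$, the inertial partition of $G$ is $(\pi_0(G),\pi_1(G),\ldots,\pi_{m-1}(G))$ and the Hermitian inertial partition of $G$ is $(\mathrm{h}\pi_0(G),\mathrm{h}\pi_1(G),\ldots,\mathrm{h}\pi_{h-1}(G))$. *)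

theory Defs
  imports "Jordan_Normal_Form.Schur_Decomposition" "Graph_Theory.Pair_Digraph"
begin

text \<open>A graph on \<open>n\<close> vertices is a \<^locale>\<open>pair_graph\<close> (a finite, loop-free, symmetric digraph without
  parallel arcs) with vertex set \<open>{0..<n}\<close>, to match the indices of \<^typ>\<open>'a mat\<close>; an edge is the pair
  of arcs \<open>(i, j)\<close> and \<open>(j, i)\<close>.\<close>

definition has_pattern :: "nat pair_pre_digraph \<Rightarrow> 'a :: zero mat \<Rightarrow> bool" where
  "has_pattern G A \<longleftrightarrow>
     (\<forall>i < dim_row A. \<forall>j < dim_col A. i \<noteq> j \<longrightarrow> (A $$ (i, j) \<noteq> 0 \<longleftrightarrow> (i, j) \<in> parcs G))"

definition sym_mats :: "nat pair_pre_digraph \<Rightarrow> real mat set" where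
  "sym_mats G =
     {A \<in> carrier_mat (card (pverts G)) (card (pverts G)). transpose_mat A = A \<and> has_pattern G A}"

definition herm_mats :: "nat pair_pre_digraph \<Rightarrow> complex mat set" where
  "herm_mats G =
     {A \<in> carrier_mat (card (pverts G)) (card (pverts G)). mat_adjoint A = A \<and> has_pattern G A}"

text \<open>Over \<^typ>\<open>complex\<close>, \<open>0 < x\<close> and \<open>x < 0\<close> refer to the partial order that makes \<open>x\<close> comparable
  to \<open>0\<close> iff \<open>x\<close> is real; this loses nothing, as a Hermitian matrix has real eigenvalues. For such
  a matrix algebraic and geometric multiplicities coincide; the algebraic one is used.\<close>

definition num_pos_eigenvalues :: "'a :: conjugatable_ordered_field mat \<Rightarrow> nat" where
  "num_pos_eigenvalues A = (\<Sum>x | eigenvalue A x \<and> 0 < x. Polynomial.order x (char_poly A))"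

definition num_neg_eigenvalues :: "'a :: conjugatable_ordered_field mat \<Rightarrow> nat" where
  "num_neg_eigenvalues A = (\<Sum>x | eigenvalue A x \<and> x < 0. Polynomial.order x (char_poly A))"

definition partial_inertia :: "'a :: conjugatable_ordered_field mat \<Rightarrow> nat \<times> nat" where
  "partial_inertia A = (num_pos_eigenvalues A, num_neg_eigenvalues A)"

definition inertia_set :: "nat pair_pre_digraph \<Rightarrow> (nat \<times> nat) set" where
  "inertia_set G = partial_inertia ` sym_mats G"

definition herm_inertia_set :: "nat pair_pre_digraph \<Rightarrow> (nat \<times> nat) set" where
  "herm_inertia_set G = partial_inertia ` herm_mats G"

text \<open>The two minima below are meant for \<open>j \<le> card (pverts G)\<close>, where they are minima of nonempty
  sets.\<close>

definition min_pos :: "nat pair_pre_digraph \<Rightarrow> nat \<Rightarrow> nat" where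
  "min_pos G j = (LEAST r. (r, j) \<in> inertia_set G)"

definition herm_min_pos :: "nat pair_pre_digraph \<Rightarrow> nat \<Rightarrow> nat" where
  "herm_min_pos G j = (LEAST r. (r, j) \<in> herm_inertia_set G)"

definition inertial_partition :: "nat pair_pre_digraph \<Rightarrow> nat list" where
  "inertial_partition G = map (min_pos G) [0..<min_pos G 0]"

definition herm_inertial_partition :: "nat pair_pre_digraph \<Rightarrow> nat list" where
  "herm_inertial_partition G = map (herm_min_pos G) [0..<herm_min_pos G 0]"

end

theory Submission
  imports Defs
begin

text \<open>Suppose that the square partition of side \<open>k > 1\<close> were the (Hermitian) inertial partition of
  \<open>G\<close>. Reading off its length gives a positive semidefinite matrix \<open>A\<close> with pattern \<open>G\<close> and
  exactly \<open>k\<close> positive eigenvalues; reading off its last part says that every matrix with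
  pattern \<open>G\<close> and \<open>k - 1\<close> negative eigenvalues has at least \<open>k\<close> positive ones. The contradiction
  comes from a matrix \<open>B\<close> with pattern \<open>G\<close> and at most \<open>k - 1\<close> eigenvalues of each sign
  (\<open>smaller_balanced_inertia\<close>).

  To find \<open>B\<close>, write \<open>A\<close> as a Gram matrix of vectors \<open>x\<^sub>i\<close> in \<open>k\<close>-space. For vectors \<open>a\<close>, \<open>b\<close> put
  \<open>\<alpha>\<^sub>i = \<Sum>\<^sub>l a\<^sub>l x\<^sub>i\<^sub>l\<close> and \<open>\<beta>\<^sub>i = \<Sum>\<^sub>l b\<^sub>l x\<^sub>i\<^sub>l\<close>, and multiply the entry \<open>(i, j)\<close> of \<open>A\<close> by
  \<open>\<alpha>\<^sub>i cnj \<beta>\<^sub>j + \<beta>\<^sub>i cnj \<alpha>\<^sub>j\<close>. The result is the Gram matrix of the vectors \<open>(\<alpha>\<^sub>i x\<^sub>i, \<beta>\<^sub>i x\<^sub>i)\<close>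
  for the hyperbolic form on \<open>2k\<close>-space that pairs the two halves, a form of signature \<open>(k, k)\<close>.
  All these vectors are annihilated by the functional \<open>(p, q) \<mapsto> \<Sum>\<^sub>l (b\<^sub>l p\<^sub>l - a\<^sub>l q\<^sub>l)\<close>. If \<open>a\<close>
  and \<open>b\<close> are orthogonal, this functional is the pairing with an isotropic vector; the vectors
  lie in its orthogonal complement, on which the form has, modulo its radical, signature
  \<open>(k - 1, k - 1)\<close>. Finally, for \<open>k > 1\<close> a generic orthogonal pair \<open>a\<close>, \<open>b\<close> makes all the
  multipliers of nonzero entries nonzero (\<open>cross_nonzero\<close> and \<open>poly_on_lines_common_nonzero\<close>),
  so that \<open>B\<close> has the pattern of \<open>A\<close>.

  Subtracting a large \<open>t\<close> from the diagonal entries of \<open>B\<close>, one entry after the other, never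
  increases the number of positive eigenvalues, raises the number of negative ones by at most
  one at each step, and makes all eigenvalues negative in the end. At some stage there are
  exactly \<open>k - 1\<close> negative eigenvalues and at most \<open>k - 1\<close> positive ones (\<open>raise_num_neg\<close>).

  The real and the complex case are treated at once, over a field that embeds into the complex
  numbers compatibly with conjugation and order.\<close>

section \<open>A common setting for real and complex scalars\<close>

text \<open>A subfield of the complex numbers that contains the reals and is closed under conjugation, that
  is, up to isomorphism the reals or the complex numbers. The embedding is part of the class so
  that the fundamental theorem of algebra can be applied to the image of a matrix.\<close>

class real_or_complex = conjugatable_ordered_field + real_field +
  fixes emb :: "'a \<Rightarrow> complex"
  assumes emb_add: "emb (x + y) = emb x + emb y"
    and emb_mult: "emb (x * y) = emb x * emb y"
    and emb_scaleR: "emb (r *\<^sub>R x) = r *\<^sub>R emb x"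
    and emb_one: "emb 1 = 1"
    and emb_conjugate: "emb (conjugate x) = cnj (emb x)"
    and emb_le_iff: "emb x \<le> emb y \<longleftrightarrow> x \<le> y"

instantiation real :: real_or_complex
begin
definition "emb = complex_of_real"
instance by standard (simp_all add: emb_real_def complex_eq_iff less_eq_complex_def)
end

instantiation complex :: real_or_complex
begin
definition "emb = (id :: complex \<Rightarrow> complex)"
instance by standard (auto simp: emb_complex_def)
end

lemma emb_of_real [simp]: "emb (of_real r :: 'a :: real_or_complex) = of_real r"
  unfolding of_real_def by (simp add: emb_scaleR emb_one)

lemma emb_eq_iff [simp]: "emb x = emb y \<longleftrightarrow> x = (y :: 'a :: real_or_complex)"
  by (metis emb_le_iff order.antisym order.refl)

interpretation emb: field_hom "emb :: 'a :: real_or_complex \<Rightarrow> complex"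
proof
  show "emb (0 :: 'a) = 0" using emb_of_real[of 0, where 'a = 'a] by simp
qed (auto simp: emb_add emb_mult emb_one)

lemma conjugate_of_real [simp]:
  "conjugate (of_real r :: 'a :: real_or_complex) = of_real r"
  using emb_eq_iff[of "conjugate (of_real r :: 'a)" "of_real r"] by (simp add: emb_conjugate)

lemma conjugate_fixed_iff: "conjugate x = x \<longleftrightarrow> (\<exists>r. x = of_real r)" for x :: "'a :: real_or_complex"
proof
  assume "conjugate x = x"
  then have "cnj (emb x) = emb x" by (metis emb_conjugate)
  then have "emb x = emb (of_real (Re (emb x)) :: 'a)" by (simp add: complex_eq_iff)
  then show "\<exists>r. x = of_real r" unfolding emb_eq_iff ..
qed auto

lemma of_real_le_iff [simp]: "(of_real r :: 'a :: real_or_complex) \<le> of_real s \<longleftrightarrow> r \<le> s"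
  using emb_le_iff[of "of_real r :: 'a" "of_real s", symmetric] by (simp add: less_eq_complex_def)

lemma of_real_less_iff [simp]: "(of_real r :: 'a :: real_or_complex) < of_real s \<longleftrightarrow> r < s"
  by (simp add: less_le)

lemma of_real_0_less_iff [simp]: "(0 :: 'a :: real_or_complex) < of_real s \<longleftrightarrow> 0 < s"
  using of_real_less_iff[of 0 s, where 'a = 'a] by simp

lemma of_real_less_0_iff [simp]: "of_real s < (0 :: 'a :: real_or_complex) \<longleftrightarrow> s < 0"
  using of_real_less_iff[of s 0, where 'a = 'a] by simp

lemma conjugate_one [simp]: "conjugate (1 :: 'a :: real_or_complex) = 1"
  using conjugate_of_real[of 1, where 'a = 'a] by simp

lemma conjugate_diff: "conjugate (a - b) = conjugate a - (conjugate b :: 'a :: real_or_complex)"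
  by (metis conjugate_dist_add conjugate_neg diff_conv_add_uminus)

lemmas conjugate_simps = conjugate_dist_mul conjugate_dist_add conjugate_neg conjugate_diff sum_conjugate

section \<open>Spectral theorem for Hermitian matrices\<close>

lemma dim_mat_adjoint [simp]:
  "dim_row (mat_adjoint A) = dim_col A" "dim_col (mat_adjoint A) = dim_row A"
  unfolding mat_adjoint_def by auto

lemma mat_adjoint_carrier [simp]: "mat_adjoint A \<in> carrier_mat m n \<longleftrightarrow> A \<in> carrier_mat n m"
  by (metis carrier_matD carrier_matI dim_mat_adjoint)

lemma index_mat_adjoint [simp]:
  "i < dim_col A \<Longrightarrow> j < dim_row A \<Longrightarrow> mat_adjoint A $$ (i, j) = conjugate (A $$ (j, i))"
  unfolding mat_adjoint_def by (simp add: mat_of_rows_index)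

lemma mat_adjoint_mat_adjoint [simp]: "mat_adjoint (mat_adjoint A) = A"
  by (rule eq_matI) auto

lemma mat_adjoint_mult:
  fixes A B :: "'a :: real_or_complex mat"
  assumes "A \<in> carrier_mat n m" "B \<in> carrier_mat m k"
  shows "mat_adjoint (A * B) = mat_adjoint B * mat_adjoint A"
  by (rule eq_matI) (use assms in \<open>auto simp: scalar_prod_def conjugate_simps mult.commute\<close>)

lemma hermitian_iff:
  assumes "A \<in> carrier_mat n n"
  shows "mat_adjoint A = A \<longleftrightarrow> (\<forall>i<n. \<forall>j<n. A $$ (i, j) = conjugate (A $$ (j, i)))" (is "_ \<longleftrightarrow> ?R")
proof
  assume a: "mat_adjoint A = A"
  show ?R
  proof (intro allI impI)
    fix i j assume "i < n" "j < n"
    then have "mat_adjoint A $$ (i, j) = conjugate (A $$ (j, i))"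
      using assms by (intro index_mat_adjoint) auto
    then show "A $$ (i, j) = conjugate (A $$ (j, i))" by (simp only: a)
  qed
next
  assume r: ?R
  show "mat_adjoint A = A"
  proof (rule eq_matI)
    fix i j assume "i < dim_row A" "j < dim_col A"
    then have "i < n" "j < n" using assms by auto
    then have "mat_adjoint A $$ (i, j) = conjugate (A $$ (j, i))"
      using assms by (intro index_mat_adjoint) auto
    also have "\<dots> = A $$ (i, j)" using r \<open>i < n\<close> \<open>j < n\<close> by metis
    finally show "mat_adjoint A $$ (i, j) = A $$ (i, j)" .
  qed (use assms in auto)
qed

text \<open>For an eigenvector \<open>v\<close> the value \<open>S\<close> of the Hermitian form at \<open>v\<close> is self-conjugate and equals
  \<open>e\<close> times the nonzero self-conjugate number \<open>N\<close>, the squared norm of \<open>v\<close>.\<close>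

lemma hermitian_eigenvalue_real:
  fixes A :: "'a :: real_or_complex mat"
  assumes A: "A \<in> carrier_mat n n" and h: "mat_adjoint A = A" and e: "eigenvalue A e"
  shows "conjugate e = e"
proof -
  from e obtain v where v: "v \<in> carrier_vec n" "v \<noteq> 0\<^sub>v n" and Av: "A *\<^sub>v v = e \<cdot>\<^sub>v v"
    using A unfolding eigenvalue_def eigenvector_def by auto
  have Avi: "(\<Sum>j<n. A $$ (i,j) * v $ j) = e * v $ i" if "i < n" for i
    using arg_cong[OF Av, of "\<lambda>w. w $ i"] A v that
    by (simp add: scalar_prod_def atLeast0LessThan)
  have hA: "conjugate (A $$ (i,j)) = A $$ (j,i)" if "i < n" "j < n" for i j
    using h that unfolding hermitian_iff[OF A] by metis
  define N where "N = (\<Sum>i<n. conjugate (v $ i) * v $ i)"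
  define S where "S = (\<Sum>i<n. \<Sum>j<n. conjugate (v $ i) * (A $$ (i,j) * v $ j))"
  have "S = (\<Sum>i<n. conjugate (v $ i) * (e * v $ i))"
    unfolding S_def by (simp add: Avi flip: sum_distrib_left)
  then have S: "S = e * N" unfolding N_def by (simp add: sum_distrib_left mult_ac)
  have "conjugate S = (\<Sum>i<n. \<Sum>j<n. v $ i * (A $$ (j,i) * conjugate (v $ j)))"
    unfolding S_def by (simp add: conjugate_simps hA)
  also have "\<dots> = S" unfolding S_def by (subst sum.swap) (simp add: mult_ac)
  finally have cS: "conjugate S = S" .
  have cN: "conjugate N = N" unfolding N_def by (simp add: conjugate_simps mult_ac)
  have "N \<noteq> 0"
  proof -
    have "v \<bullet>c v = N" using v unfolding N_def by (simp add: scalar_prod_def atLeast0LessThan mult_ac)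
    then show ?thesis using v conjugate_square_eq_0_vec[OF v(1)] by auto
  qed
  have "conjugate e * N = e * N" using cS unfolding S by (simp add: conjugate_dist_mul cN)
  with \<open>N \<noteq> 0\<close> show ?thesis by simp
qed

text \<open>Over the complex numbers every polynomial splits; since the roots are real, the factorization
  already takes place over the original field.\<close>

lemma hermitian_char_poly_splits:
  fixes A :: "'a :: real_or_complex mat"
  assumes A: "A \<in> carrier_mat n n" and h: "mat_adjoint A = A"
  shows "\<exists>es. char_poly A = (\<Prod>e\<leftarrow>es. [:- of_real e, 1:])"
proof -
  let ?A = "map_mat emb A"
  have cA: "?A \<in> carrier_mat n n" using A by simp
  have hA: "mat_adjoint ?A = ?A"
  proof (rule eq_matI)
    fix i j assume ij: "i < dim_row ?A" "j < dim_col ?A"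
    then have "A $$ (i,j) = conjugate (A $$ (j,i))" using A h hermitian_iff[OF A] by (metis carrier_matD index_map_mat(2,3))
    then show "mat_adjoint ?A $$ (i,j) = ?A $$ (i,j)" using ij A by (simp add: emb_conjugate del: emb_eq_iff)
  qed (use A in auto)
  from char_poly_factorized[OF cA] obtain as where as: "char_poly ?A = (\<Prod>a\<leftarrow>as. [:- a, 1:])" by auto
  have "\<exists>r. a = complex_of_real r" if "a \<in> set as" for a
  proof -
    have "poly (char_poly ?A) a = 0" unfolding as using that by (simp add: poly_prod_list prod_list_zero_iff)
    then have "eigenvalue ?A a" using eigenvalue_root_char_poly[OF cA] by simp
    from hermitian_eigenvalue_real[OF cA hA this] show ?thesis unfolding conjugate_fixed_iff .
  qed
  then obtain f where f: "\<And>a. a \<in> set as \<Longrightarrow> a = complex_of_real (f a)" by metis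
  interpret mp: map_poly_inj_comm_ring_hom "emb :: 'a \<Rightarrow> complex" ..
  have "map_poly emb (char_poly A) = (\<Prod>a\<leftarrow>as. [:- a, 1:])"
    using emb.char_poly_hom[OF A] as by simp
  also have "\<dots> = map_poly emb (\<Prod>e\<leftarrow>map f as. [:- of_real e, 1:] :: 'a poly)"
    unfolding mp.hom_prod_list map_map o_def
    by (intro arg_cong[of _ _ prod_list] map_cong) (auto simp: f[symmetric] emb.hom_uminus)
  finally show ?thesis using mp.injectivity by blast
qed

lemma nonzero_vec_dim:
  assumes "v \<in> carrier_vec n" "v \<noteq> 0\<^sub>v n"
  shows "n \<noteq> 0"
proof
  assume n: "n = 0"
  have "v = 0\<^sub>v n" by (rule eq_vecI) (use assms(1) n in auto)
  with assms(2) show False by simp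
qed

text \<open>Complete \<open>v\<close> to a basis, orthogonalize it and divide each vector by its norm. The square roots
  needed for the norms exist because the field contains the reals.\<close>

lemma unitary_first_column:
  fixes v :: "'a :: real_or_complex vec"
  assumes v: "v \<in> carrier_vec n" "v \<noteq> 0\<^sub>v n"
  obtains W c where "W \<in> carrier_mat n n" "mat_adjoint W * W = 1\<^sub>m n" "col W 0 = c \<cdot>\<^sub>v v"
proof -
  interpret cof_vec_space n "TYPE('a)" .
  define b where "b = basis_completion v"
  define ws where "ws = gram_schmidt n b"
  from basis_completion[OF v, folded b_def]
  have dist_b: "distinct b" and indep: "\<not> lin_dep (set b)" and b: "set b \<subseteq> carrier_vec n"
    and hdb: "hd b = v" and len_b: "length b = n" by auto
  have n0: "n \<noteq> 0" by (rule nonzero_vec_dim[OF v])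
  with hdb len_b obtain vs where bv: "b = v # vs" by (cases b) auto
  from gram_schmidt_result[OF b dist_b indep refl, folded ws_def]
  have ws: "set ws \<subseteq> carrier_vec n" "corthogonal ws" "length ws = n" by (auto simp: len_b)
  from gram_schmidt_hd[OF v(1), of vs, folded bv] have hdws: "hd ws = v" unfolding ws_def .
  then have ws0: "ws ! 0 = v" using ws(3) n0 by (cases ws) auto
  have wsc: "ws ! j \<in> carrier_vec n" if "j < n" for j using ws that by auto
  have "\<exists>s. s > 0 \<and> ws ! j \<bullet>c ws ! j = of_real (s * s)" if j: "j < n" for j
  proof -
    have ne: "ws ! j \<bullet>c ws ! j \<noteq> 0" using corthogonalD[OF ws(2)] j ws(3) by simp
    have "ws ! j \<bullet>c ws ! j \<ge> 0" using conjugate_square_ge_0_vec .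
    moreover have "conjugate (ws ! j \<bullet>c ws ! j) = ws ! j \<bullet>c ws ! j"
      using wsc[OF j] by (simp add: scalar_prod_def conjugate_simps mult.commute)
    ultimately obtain r where r: "ws ! j \<bullet>c ws ! j = of_real r" "r \<ge> 0"
      unfolding conjugate_fixed_iff using of_real_le_iff[of 0, where 'a = 'a] by auto
    with ne have "r > 0" by (cases "r = 0") auto
    with r show ?thesis by (intro exI[of _ "sqrt r"]) auto
  qed
  then obtain s where s: "\<And>j. j < n \<Longrightarrow> s j > 0" 
    and ss: "\<And>j. j < n \<Longrightarrow> ws ! j \<bullet>c ws ! j = of_real (s j * s j)" by metis
  define W where "W = mat n n (\<lambda>(i,j). ws ! j $ i / of_real (s j))"
  have W: "W \<in> carrier_mat n n" unfolding W_def by simp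
  have "mat_adjoint W * W = 1\<^sub>m n"
  proof (rule eq_matI)
    fix i j assume ij: "i < dim_row (1\<^sub>m n :: 'a mat)" "j < dim_col (1\<^sub>m n :: 'a mat)"
    then have ij: "i < n" "j < n" by auto
    have cdiv: "conjugate (x / of_real (s i)) = conjugate x / of_real (s i)" for x :: 'a
    proof -
      have "conjugate (x / of_real (s i)) = conjugate (x * of_real (inverse (s i)))"
        by (simp add: divide_inverse)
      then show ?thesis by (simp only: conjugate_dist_mul conjugate_of_real) (simp add: divide_inverse)
    qed
    have "(mat_adjoint W * W) $$ (i,j) = (\<Sum>k<n. conjugate (W $$ (k,i)) * W $$ (k,j))"
      using ij W by (simp add: scalar_prod_def atLeast0LessThan)
    also have "\<dots> = (\<Sum>k<n. conjugate (ws ! i $ k) * ws ! j $ k) / of_real (s i * s j)"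
      unfolding sum_divide_distrib
      by (intro sum.cong refl) (use ij in \<open>simp add: W_def cdiv\<close>)
    also have "(\<Sum>k<n. conjugate (ws ! i $ k) * ws ! j $ k) = ws ! j \<bullet>c ws ! i"
      using wsc[OF ij(1)] wsc[OF ij(2)] by (simp add: scalar_prod_def atLeast0LessThan mult.commute)
    also have "\<dots> / of_real (s i * s j) = (if i = j then 1 else 0)"
    proof (cases "i = j")
      case True
      then show ?thesis using ss[of i] s[of i] ij by simp
    next
      case False
      then have "ws ! j \<bullet>c ws ! i = 0" using corthogonalD[OF ws(2)] ij ws(3) by metis
      then show ?thesis using False by simp
    qed
    finally show "(mat_adjoint W * W) $$ (i,j) = 1\<^sub>m n $$ (i,j)" using ij by simp
  qed (use W in auto)
  moreover have "col W 0 = (1 / of_real (s 0)) \<cdot>\<^sub>v v"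
    by (rule eq_vecI) (use W n0 v ws0 in \<open>auto simp: W_def\<close>)
  ultimately show ?thesis using that W by blast
qed

lemma hermitian_congruence:
  fixes A :: "'a :: real_or_complex mat"
  assumes "A \<in> carrier_mat n n" "W \<in> carrier_mat n n" "mat_adjoint A = A"
  shows "mat_adjoint (mat_adjoint W * A * W) = mat_adjoint W * A * W"
proof -
  have W': "mat_adjoint W \<in> carrier_mat n n" using assms by simp
  have "mat_adjoint (mat_adjoint W * A * W) = mat_adjoint W * (mat_adjoint A * W)"
    using assms W' by (simp add: mat_adjoint_mult[of _ n n _ n])
  then show ?thesis using assms W' by simp
qed

lemma mat_adjoint_four_block:
  assumes "A \<in> carrier_mat nr1 nc1" "B \<in> carrier_mat nr1 nc2"
    "C \<in> carrier_mat nr2 nc1" "D \<in> carrier_mat nr2 nc2"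
  shows "mat_adjoint (four_block_mat A B C D) =
    four_block_mat (mat_adjoint A) (mat_adjoint C) (mat_adjoint B) (mat_adjoint D)"
  by (rule eq_matI) (use assms in auto)

definition diag_of :: "real list \<Rightarrow> 'a :: real_or_complex mat" where
  "diag_of es = mat (length es) (length es) (\<lambda>(i, j). if i = j then of_real (es ! i) else 0)"

text \<open>Deflation: a unitary matrix whose first column is an eigenvector conjugates \<open>A\<close> into a matrix
  whose first column, and by symmetry first row, vanishes off the diagonal. The remaining block
  is again Hermitian and its characteristic polynomial has lost the factor of that eigenvalue.\<close>

lemma unitary_diagonalization:
  fixes A :: "'a :: real_or_complex mat"
  assumes A: "A \<in> carrier_mat n n" "mat_adjoint A = A"
    and cp: "char_poly A = (\<Prod>e\<leftarrow>es. [:- of_real e, 1:])"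
  shows "\<exists>U \<in> carrier_mat n n. mat_adjoint U * U = 1\<^sub>m n \<and> mat_adjoint U * A * U = diag_of es \<and> length es = n"
  using assms
proof (induction es arbitrary: n A)
  case Nil
  with degree_monic_char_poly[of A n] have "n = 0" by simp
  then show ?case using Nil by (intro bexI[of _ "1\<^sub>m 0"]) (auto simp: diag_of_def)
next
  case (Cons e es)
  note A = Cons.prems(1,2) and cp = Cons.prems(3)
  have "eigenvalue A (of_real e)"
    unfolding eigenvalue_root_char_poly[OF A(1)] cp by simp
  then obtain v where v: "v \<in> carrier_vec n" "v \<noteq> 0\<^sub>v n" and Av: "A *\<^sub>v v = of_real e \<cdot>\<^sub>v v"
    using A unfolding eigenvalue_def eigenvector_def by auto
  with nonzero_vec_dim obtain m where n: "n = Suc m" by (metis not0_implies_Suc)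
  from unitary_first_column[OF v] obtain W c where W: "W \<in> carrier_mat n n"
    and WW: "mat_adjoint W * W = 1\<^sub>m n" and colW: "col W 0 = c \<cdot>\<^sub>v v" .
  have W': "mat_adjoint W \<in> carrier_mat n n" using W by simp
  have WW': "W * mat_adjoint W = 1\<^sub>m n" using mat_mult_left_right_inverse[OF W' W WW] .
  define B where "B = mat_adjoint W * A * W"
  have B: "B \<in> carrier_mat n n" unfolding B_def using W W' A by simp
  have hB: "mat_adjoint B = B" unfolding B_def by (rule hermitian_congruence[OF A(1) W A(2)])
  have AW0: "A *\<^sub>v col W 0 = of_real e \<cdot>\<^sub>v col W 0"
    unfolding colW using A v Av by (simp add: mult_mat_vec smult_smult_assoc mult.commute)
  have colB: "B $$ (i, 0) = (if i = 0 then of_real e else 0)" if i: "i < n" for i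
  proof -
    have "B = mat_adjoint W * (A * W)" unfolding B_def using A W W' by simp
    then have "B $$ (i, 0) = row (mat_adjoint W) i \<bullet> col (A * W) 0"
      using A W W' i n by (simp del: col_mult2)
    also have "col (A * W) 0 = A *\<^sub>v col W 0"
      using A W n by (intro col_mult2[of _ n n _ n]) auto
    finally have "B $$ (i, 0) = row (mat_adjoint W) i \<bullet> (A *\<^sub>v col W 0)" .
    also have "\<dots> = of_real e * (row (mat_adjoint W) i \<bullet> col W 0)"
      unfolding AW0 by (rule scalar_prod_smult_distrib[of _ n]) (use W' W i in auto)
    also have "row (mat_adjoint W) i \<bullet> col W 0 = (mat_adjoint W * W) $$ (i, 0)"
      using W W' i n by simp
    also have "\<dots> = (if i = 0 then 1 else 0)" unfolding WW using i n by simp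
    finally show ?thesis by simp
  qed
  have rowB: "B $$ (0, j) = (if j = 0 then of_real e else 0)" if j: "j < n" for j
  proof -
    have "B $$ (0, j) = conjugate (B $$ (j, 0))" using hB j n unfolding hermitian_iff[OF B] by blast
    then show ?thesis using colB[OF j] by simp
  qed
  define D where "D = mat m m (\<lambda>(i, j). B $$ (Suc i, Suc j))"
  define E where "E = mat 1 1 (\<lambda>_. of_real e :: 'a)"
  have D: "D \<in> carrier_mat m m" and E: "E \<in> carrier_mat 1 1" unfolding D_def E_def by auto
  have Bblock: "B = four_block_mat E (0\<^sub>m 1 m) (0\<^sub>m m 1) D"
  proof (rule eq_matI)
    fix i j assume "i < dim_row (four_block_mat E (0\<^sub>m 1 m) (0\<^sub>m m 1) D)"
      "j < dim_col (four_block_mat E (0\<^sub>m 1 m) (0\<^sub>m m 1) D)"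
    then have "i < n" "j < n" using D E n by auto
    then show "B $$ (i, j) = four_block_mat E (0\<^sub>m 1 m) (0\<^sub>m m 1) D $$ (i, j)"
      using colB rowB n by (cases i; cases j) (auto simp: D_def E_def)
  qed (use B D E n in auto)
  have hD: "mat_adjoint D = D"
    unfolding hermitian_iff[OF D]
  proof (intro allI impI)
    fix i j assume ij: "i < m" "j < m"
    then have "B $$ (Suc i, Suc j) = conjugate (B $$ (Suc j, Suc i))"
      using hB n unfolding hermitian_iff[OF B] by blast
    then show "D $$ (i, j) = conjugate (D $$ (j, i))" using ij unfolding D_def by simp
  qed
  have "similar_mat_wit B A (mat_adjoint W) W"
    by (rule similar_mat_witI[of _ _ n]) (use W W' WW WW' A B in \<open>auto simp: B_def\<close>)
  then have "char_poly B = char_poly A"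
    by (intro char_poly_similar) (auto simp: similar_mat_def)
  moreover have "char_poly B = char_poly E * char_poly D"
    unfolding Bblock by (rule char_poly_four_block_zeros_col[OF E _ D]) simp
  moreover have "char_poly E = [: - of_real e, 1 :]"
    by (simp add: E_def char_poly_defs det_def sign_def)
  ultimately have "[: - of_real e, 1 :] * char_poly D = [: - of_real e, 1 :] * (\<Prod>e\<leftarrow>es. [:- of_real e, 1:])"
    using cp by simp
  then have "char_poly D = (\<Prod>e\<leftarrow>es. [:- of_real e, 1:])"
    by (metis mult_cancel_left pCons_eq_0_iff zero_neq_one)
  from Cons.IH[OF D hD this] obtain V where V: "V \<in> carrier_mat m m" "mat_adjoint V * V = 1\<^sub>m m"
    and VD: "mat_adjoint V * D * V = diag_of es" and len: "length es = m" by auto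
  define F where "F = four_block_mat (1\<^sub>m 1) (0\<^sub>m 1 m) (0\<^sub>m m 1) V"
  have F: "F \<in> carrier_mat n n" unfolding F_def n using V by auto
  have F': "mat_adjoint F = four_block_mat (1\<^sub>m 1) (0\<^sub>m 1 m) (0\<^sub>m m 1) (mat_adjoint V)"
    unfolding F_def using V by (subst mat_adjoint_four_block[of _ 1 1 _ m _ m]) auto
  have F'c: "mat_adjoint F \<in> carrier_mat n n" using F by simp
  have V': "mat_adjoint V \<in> carrier_mat m m" using V by simp
  have FF: "mat_adjoint F * F = 1\<^sub>m n"
    unfolding F' unfolding F_def
    by (subst mult_four_block_mat[of _ 1 1 _ m _ m _ _ 1 _ m])
       (use V V' n in \<open>auto intro!: eq_matI\<close>)
  have FBF: "mat_adjoint F * B * F = diag_of (e # es)"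
  proof -
    have "mat_adjoint F * B * F = four_block_mat E (0\<^sub>m 1 m) (0\<^sub>m m 1) (mat_adjoint V * D * V)"
      unfolding F' Bblock unfolding F_def using V V' D E
      by (simp add: mult_four_block_mat[of _ 1 1 _ m _ m _ _ 1 _ m] left_add_zero_mat[of _ 1 1] del: One_nat_def)
    also have "\<dots> = diag_of (e # es)" unfolding VD
      by (rule eq_matI) (use len in \<open>auto simp: diag_of_def E_def nth_Cons' Suc_diff_Suc\<close>)
    finally show ?thesis .
  qed
  define U where "U = W * F"
  have U: "U \<in> carrier_mat n n" unfolding U_def using W F by simp
  have U': "mat_adjoint U = mat_adjoint F * mat_adjoint W"
    unfolding U_def by (rule mat_adjoint_mult[OF W F])
  have "mat_adjoint U * U = mat_adjoint F * ((mat_adjoint W * W) * F)"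
    unfolding U' unfolding U_def using W W' F F'c by (simp add: assoc_mult_mat[of _ n n _ n _ n])
  then have "mat_adjoint U * U = 1\<^sub>m n" using WW FF F by simp
  moreover have "mat_adjoint U * A * U = mat_adjoint F * B * F"
    unfolding U' unfolding U_def B_def using W W' F F'c A by (simp add: assoc_mult_mat[of _ n n _ n _ n])
  ultimately show ?case using U FBF len n by auto
qed

text \<open>Taking the squared absolute value in the complex numbers makes it a real number, as needed for
  the comparison of signs.\<close>

definition sqnorm :: "'a :: real_or_complex \<Rightarrow> real" where
  "sqnorm x = (cmod (emb x))\<^sup>2"

lemma mult_conjugate: "x * conjugate x = of_real (sqnorm x)"
proof -
  have "emb (x * conjugate x) = emb (of_real (sqnorm x) :: 'a)"
    by (simp only: emb_mult emb_conjugate emb_of_real sqnorm_def complex_norm_square)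
  then show ?thesis unfolding emb_eq_iff .
qed

lemma sqnorm_nonneg: "sqnorm x \<ge> 0"
  unfolding sqnorm_def by simp

lemma sqnorm_pos: "x \<noteq> 0 \<Longrightarrow> sqnorm x > 0"
  unfolding sqnorm_def by simp

text \<open>An orthonormal basis of eigenvectors \<open>u l\<close> and the resulting expansion of \<open>A\<close> into rank-one
  matrices, in terms of sums of scalars: the later arguments manipulate such sums for index sets
  of varying size.\<close>

definition eigendecomposition ::
    "'a :: real_or_complex mat \<Rightarrow> nat \<Rightarrow> real list \<Rightarrow> (nat \<Rightarrow> nat \<Rightarrow> 'a) \<Rightarrow> bool" where
  "eigendecomposition A n es u \<longleftrightarrow>
    length es = n \<and> char_poly A = (\<Prod>e\<leftarrow>es. [:- of_real e, 1:]) \<and>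
    (\<forall>l<n. \<forall>m<n. (\<Sum>i<n. conjugate (u l i) * u m i) = (if l = m then 1 else 0)) \<and>
    (\<forall>i<n. \<forall>j<n. A $$ (i, j) = (\<Sum>l<n. of_real (es ! l) * (u l i * conjugate (u l j))))"

lemma spectral_theorem:
  fixes A :: "'a :: real_or_complex mat"
  assumes A: "A \<in> carrier_mat n n" "mat_adjoint A = A"
  shows "\<exists>es u. eigendecomposition A n es u"
proof -
  from hermitian_char_poly_splits[OF A] obtain es where cp: "char_poly A = (\<Prod>e\<leftarrow>es. [:- of_real e, 1:])" ..
  from unitary_diagonalization[OF A cp] obtain U where U: "U \<in> carrier_mat n n"
    and UU: "mat_adjoint U * U = 1\<^sub>m n" and D: "mat_adjoint U * A * U = diag_of es" and len: "length es = n" by auto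
  have U': "mat_adjoint U \<in> carrier_mat n n" using U by simp
  have UU': "U * mat_adjoint U = 1\<^sub>m n" using mat_mult_left_right_inverse[OF U' U UU] .
  have Dc: "diag_of es \<in> carrier_mat n n" using len by (simp add: diag_of_def)
  have "U * (diag_of es * mat_adjoint U) = (U * mat_adjoint U) * (A * (U * mat_adjoint U))"
    unfolding D[symmetric] using U U' A by (simp add: assoc_mult_mat[of _ n n _ n _ n])
  then have AU: "A = U * (diag_of es * mat_adjoint U)" using UU' A by simp
  have "eigendecomposition A n es (\<lambda>l i. U $$ (i, l))"
    unfolding eigendecomposition_def
  proof (intro conjI allI impI)
    fix l m assume lm: "l < n" "m < n"
    have "(\<Sum>i<n. conjugate (U $$ (i, l)) * U $$ (i, m)) = (mat_adjoint U * U) $$ (l, m)"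
      using U lm by (simp add: scalar_prod_def atLeast0LessThan)
    then show "(\<Sum>i<n. conjugate (U $$ (i, l)) * U $$ (i, m)) = (if l = m then 1 else 0)"
      unfolding UU using lm by simp
  next
    fix i j assume ij: "i < n" "j < n"
    have d: "(diag_of es * mat_adjoint U) $$ (l, j) = of_real (es ! l) * conjugate (U $$ (j, l))" if "l < n" for l
    proof -
      have "(diag_of es * mat_adjoint U) $$ (l, j) =
        (\<Sum>m<n. (if l = m then of_real (es ! l) else 0) * conjugate (U $$ (j, m)))"
        using that ij U Dc len by (simp add: scalar_prod_def atLeast0LessThan diag_of_def)
      also have "\<dots> = (\<Sum>m<n. if l = m then of_real (es ! l) * conjugate (U $$ (j, m)) else 0)"
        by (intro sum.cong) auto
      finally show ?thesis using that by simp
    qed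
    define X where "X = diag_of es * mat_adjoint U"
    have X: "X \<in> carrier_mat n n" unfolding X_def by (rule mult_carrier_mat[OF Dc U'])
    have "A $$ (i, j) = (U * X) $$ (i, j)" unfolding X_def using AU by simp
    also have "\<dots> = (\<Sum>l<n. U $$ (i, l) * X $$ (l, j))"
      using ij U X by (simp add: scalar_prod_def atLeast0LessThan)
    finally have "A $$ (i, j) = (\<Sum>l<n. U $$ (i, l) * (diag_of es * mat_adjoint U) $$ (l, j))"
      unfolding X_def .
    then show "A $$ (i, j) = (\<Sum>l<n. of_real (es ! l) * (U $$ (i, l) * conjugate (U $$ (j, l))))"
      by (simp add: d mult_ac)
  qed (fact len cp)+
  then show ?thesis by blast
qed

section \<open>Inertia as the smallest signature of a sum of squares\<close>

lemma order_prod_linear: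
  "Polynomial.order x (\<Prod>e\<leftarrow>es. [:- e, 1:]) = count_list es (x :: 'a :: field)"
proof (induction es)
  case (Cons e es)
  have ne: "[:- e, 1:] * (\<Prod>e\<leftarrow>es. [:- e, 1:]) \<noteq> 0"
    by (intro no_zero_divisors) (auto simp: prod_list_zero_iff)
  have "Polynomial.order x [:- e, 1:] = (if e = x then 1 else 0)"
    by (auto simp: order_linear' order_0I)
  then show ?case using Cons order_mult[OF ne, of x] by simp
qed simp

lemma poly_prod_linear_eq_0_iff:
  "poly (\<Prod>e\<leftarrow>es. [:- e, 1:]) x = 0 \<longleftrightarrow> x \<in> set (es :: 'a :: field list)"
  by (induction es) auto

lemma sum_count_list_filter:
  "(\<Sum>x | x \<in> set xs \<and> P x. count_list xs x) = length (filter P xs)"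
proof -
  have c: "count_list xs x = count_list (filter P xs) x" if "P x" for x
    using that by (induction xs) auto
  have "(\<Sum>x | x \<in> set xs \<and> P x. count_list xs x) = (\<Sum>x\<in>set (filter P xs). count_list (filter P xs) x)"
    by (rule sum.cong) (auto simp: c)
  then show ?thesis by (simp add: sum_count_set)
qed

lemma num_eigenvalues_eq_card:
  fixes A :: "'a :: real_or_complex mat"
  assumes A: "A \<in> carrier_mat n n" and cp: "char_poly A = (\<Prod>e\<leftarrow>es. [:- of_real e, 1:])"
  shows "num_pos_eigenvalues A = card {l. l < length es \<and> es ! l > 0}"
    and "num_neg_eigenvalues A = card {l. l < length es \<and> es ! l < 0}"
proof -
  let ?xs = "map of_real es :: 'a list"
  have cp': "char_poly A = (\<Prod>e\<leftarrow>?xs. [:- e, 1:])" unfolding cp by (simp add: o_def)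
  have ev: "eigenvalue A x \<longleftrightarrow> x \<in> set ?xs" for x
    unfolding eigenvalue_root_char_poly[OF A] cp' by (rule poly_prod_linear_eq_0_iff)
  have "num_pos_eigenvalues A = length (filter (\<lambda>x. 0 < x) ?xs)"
    unfolding num_pos_eigenvalues_def ev cp' order_prod_linear by (rule sum_count_list_filter)
  then show "num_pos_eigenvalues A = card {l. l < length es \<and> es ! l > 0}"
    by (simp add: filter_map o_def length_filter_conv_card)
  have "num_neg_eigenvalues A = length (filter (\<lambda>x. x < 0) ?xs)"
    unfolding num_neg_eigenvalues_def ev cp' order_prod_linear by (rule sum_count_list_filter)
  then show "num_neg_eigenvalues A = card {l. l < length es \<and> es ! l < 0}"
    by (simp add: filter_map o_def length_filter_conv_card)
qed

text \<open>\<open>A\<close> is a difference of sums of \<open>r\<close> and of \<open>s\<close> rank-one positive semidefinite matrices. By the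
  two results \<open>signature_le_inertia\<close> and \<open>inertia_le_signature\<close> below, the partial inertia is
  the least such pair \<open>(r, s)\<close>; this turns bounds on eigenvalues into identities between sums.\<close>

definition signature_le :: "'a :: real_or_complex mat \<Rightarrow> nat \<Rightarrow> nat \<Rightarrow> bool" where
  "signature_le A r s \<longleftrightarrow> (\<exists>x y. \<forall>i<dim_row A. \<forall>j<dim_col A.
     A $$ (i, j) = (\<Sum>l<r. x l i * conjugate (x l j)) - (\<Sum>l<s. y l i * conjugate (y l j)))"

lemma signature_leI:
  fixes A :: "'a :: real_or_complex mat"
  assumes fin: "finite I" "finite J"
    and eq: "\<And>i j. i < dim_row A \<Longrightarrow> j < dim_col A \<Longrightarrow> A $$ (i, j) =
      (\<Sum>l\<in>I. x l i * conjugate (x l j)) - (\<Sum>l\<in>J. y l i * conjugate (y l j))"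
  shows "signature_le A (card I) (card J)"
proof -
  obtain f where f: "bij_betw f {..<card I} I"
    using ex_bij_betw_nat_finite[OF fin(1)] by (auto simp: atLeast0LessThan)
  obtain g where g: "bij_betw g {..<card J} J"
    using ex_bij_betw_nat_finite[OF fin(2)] by (auto simp: atLeast0LessThan)
  show ?thesis unfolding signature_le_def
  proof (intro exI allI impI)
    fix i j assume "i < dim_row A" "j < dim_col A"
    from eq[OF this] show "A $$ (i, j) = (\<Sum>l<card I. x (f l) i * conjugate (x (f l) j))
        - (\<Sum>l<card J. y (g l) i * conjugate (y (g l) j))"
      using sum.reindex_bij_betw[OF f, of "\<lambda>l. x l i * conjugate (x l j)"]
        sum.reindex_bij_betw[OF g, of "\<lambda>l. y l i * conjugate (y l j)"] by simp
  qed
qed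

lemma signature_le_inertia:
  fixes A :: "'a :: real_or_complex mat"
  assumes A: "A \<in> carrier_mat n n" "mat_adjoint A = A"
  shows "signature_le A (num_pos_eigenvalues A) (num_neg_eigenvalues A)"
proof -
  from spectral_theorem[OF A] obtain es u where ed: "eigendecomposition A n es u" by blast
  have len: "length es = n" and cp: "char_poly A = (\<Prod>e\<leftarrow>es. [:- of_real e, 1:])"
    using ed unfolding eigendecomposition_def by auto
  have Au: "\<And>i j. i < n \<Longrightarrow> j < n \<Longrightarrow> A $$ (i, j) = (\<Sum>l<n. of_real (es ! l) * (u l i * conjugate (u l j)))"
    using ed unfolding eigendecomposition_def by blast
  let ?I = "{l. l < length es \<and> es ! l > 0}" and ?J = "{l. l < length es \<and> es ! l < 0}"
  let ?x = "\<lambda>l i. of_real (sqrt \<bar>es ! l\<bar>) * u l i"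
  have x: "?x l i * conjugate (?x l j) = of_real \<bar>es ! l\<bar> * (u l i * conjugate (u l j))" for l i j
  proof -
    have "(of_real (sqrt \<bar>es ! l\<bar>) * of_real (sqrt \<bar>es ! l\<bar>) :: 'a) = of_real \<bar>es ! l\<bar>"
      by (simp flip: of_real_mult)
    then show ?thesis by (simp add: conjugate_dist_mul mult_ac)
  qed
  have "signature_le A (card ?I) (card ?J)"
  proof (rule signature_leI[where x = ?x and y = ?x])
    fix i j assume "i < dim_row A" "j < dim_col A"
    then have ij: "i < n" "j < n" using A by auto
    have "A $$ (i, j) = (\<Sum>l<n. (if es ! l > 0 then ?x l i * conjugate (?x l j) else 0)
        - (if es ! l < 0 then ?x l i * conjugate (?x l j) else 0))"
      unfolding Au[OF ij] x by (intro sum.cong) auto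
    also have "\<dots> = (\<Sum>l\<in>?I. ?x l i * conjugate (?x l j)) - (\<Sum>l\<in>?J. ?x l i * conjugate (?x l j))"
      unfolding sum_subtractf
      by (subst (1 2) sum.inter_filter[symmetric]) (auto simp: len intro!: arg_cong2[of _ _ _ _ minus] sum.cong)
    finally show "A $$ (i, j) = (\<Sum>l\<in>?I. ?x l i * conjugate (?x l j)) - (\<Sum>l\<in>?J. ?x l i * conjugate (?x l j))" .
  qed auto
  then show ?thesis unfolding num_eigenvalues_eq_card[OF A(1) cp] .
qed

text \<open>Gaussian elimination: the last equation is either vacuous or can be solved for the unknown of a
  pivot \<open>p\<close>, which leaves one equation and one unknown less.\<close>

lemma underdetermined_system:
  fixes a :: "nat \<Rightarrow> 'i \<Rightarrow> 'a :: field"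
  assumes "finite I" "r < card I"
  shows "\<exists>c. (\<exists>l\<in>I. c l \<noteq> 0) \<and> (\<forall>m<r. (\<Sum>l\<in>I. a m l * c l) = 0)"
  using assms
proof (induction r arbitrary: I a)
  case 0
  then have "I \<noteq> {}" by auto
  then show ?case by (intro exI[of _ "\<lambda>_. 1"]) auto
next
  case (Suc r)
  show ?case
  proof (cases "\<forall>l\<in>I. a r l = 0")
    case True
    from Suc.IH[of I a] Suc.prems obtain c where c: "\<exists>l\<in>I. c l \<noteq> 0" "\<forall>m<r. (\<Sum>l\<in>I. a m l * c l) = 0" by auto
    moreover have "(\<Sum>l\<in>I. a r l * c l) = 0" using True by simp
    ultimately show ?thesis by (auto simp: less_Suc_eq)
  next
    case False
    then obtain p where p: "p \<in> I" "a r p \<noteq> 0" by auto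
    let ?I = "I - {p}"
    have "finite ?I" "r < card ?I" using Suc.prems p by auto
    from Suc.IH[OF this, of "\<lambda>m l. a m l - a m p * a r l / a r p"] obtain c where
      c: "\<exists>l\<in>?I. c l \<noteq> 0" "\<forall>m<r. (\<Sum>l\<in>?I. (a m l - a m p * a r l / a r p) * c l) = 0" by auto
    define cp where "cp = - (\<Sum>l\<in>?I. a r l * c l) / a r p"
    have s: "(\<Sum>l\<in>I. a m l * (c(p := cp)) l) = a m p * cp + (\<Sum>l\<in>?I. a m l * c l)" for m
      using Suc.prems(1) p by (subst sum.remove[of _ p]) (auto intro!: sum.cong)
    have "(\<Sum>l\<in>I. a m l * (c(p := cp)) l) = 0" if "m < Suc r" for m
    proof (cases "m = r")
      case True
      then show ?thesis unfolding s unfolding cp_def using p by simp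
    next
      case False
      with that c(2) have "(\<Sum>l\<in>?I. (a m l - a m p * a r l / a r p) * c l) = 0" by auto
      then have "(\<Sum>l\<in>?I. a m l * c l) - (\<Sum>l\<in>?I. a m p / a r p * (a r l * c l)) = 0"
        by (simp add: algebra_simps sum_subtractf)
      then show ?thesis unfolding s unfolding cp_def sum_distrib_left[symmetric] by (simp add: algebra_simps)
    qed
    moreover have "\<exists>l\<in>I. (c(p := cp)) l \<noteq> 0" using c(1) by auto
    ultimately show ?thesis by blast
  qed
qed

lemma quadratic_form_sum:
  fixes w :: "nat \<Rightarrow> 'a :: real_or_complex"
  shows "(\<Sum>i<n. \<Sum>j<n. conjugate (w i) * (\<Sum>l\<in>L. of_real (g l) * (z l i * conjugate (z l j))) * w j) =
    of_real (\<Sum>l\<in>L. g l * sqnorm (\<Sum>j<n. conjugate (z l j) * w j))"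
proof -
  have "(\<Sum>i<n. \<Sum>j<n. conjugate (w i) * (\<Sum>l\<in>L. of_real (g l) * (z l i * conjugate (z l j))) * w j) =
    (\<Sum>i<n. \<Sum>j<n. \<Sum>l\<in>L. of_real (g l) * ((conjugate (z l j) * w j) * (z l i * conjugate (w i))))"
    by (simp add: sum_distrib_left sum_distrib_right mult_ac)
  also have "\<dots> = (\<Sum>i<n. \<Sum>l\<in>L. \<Sum>j<n. of_real (g l) * ((conjugate (z l j) * w j) * (z l i * conjugate (w i))))"
    by (intro sum.cong refl sum.swap)
  also have "\<dots> = (\<Sum>l\<in>L. \<Sum>i<n. \<Sum>j<n. of_real (g l) * ((conjugate (z l j) * w j) * (z l i * conjugate (w i))))"
    by (rule sum.swap)
  also have "\<dots> = (\<Sum>l\<in>L. of_real (g l) * ((\<Sum>j<n. conjugate (z l j) * w j) * conjugate (\<Sum>j<n. conjugate (z l j) * w j)))"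
    by (simp add: sum_distrib_left sum_distrib_right conjugate_simps mult_ac)
  also have "\<dots> = of_real (\<Sum>l\<in>L. g l * sqnorm (\<Sum>j<n. conjugate (z l j) * w j))"
    by (simp add: mult_conjugate)
  finally show ?thesis .
qed

text \<open>The inequality in Sylvester's law of inertia. The form given by \<open>e\<close> and \<open>u\<close> is positive definite
  on the span of the \<open>u l\<close> with \<open>e l > 0\<close>. If there were more than \<open>r\<close> of them, some nonzero \<open>w\<close>
  in that span would be orthogonal to all the \<open>x l\<close>, and the second expression shows that the
  form is not positive at \<open>w\<close>.\<close>

lemma positive_part_le:
  fixes u x y :: "nat \<Rightarrow> nat \<Rightarrow> 'a :: real_or_complex" and e :: "nat \<Rightarrow> real"
  assumes orth: "\<And>l m. l < n \<Longrightarrow> m < n \<Longrightarrow> (\<Sum>i<n. conjugate (u l i) * u m i) = (if l = m then 1 else 0)"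
    and eq: "\<And>i j. i < n \<Longrightarrow> j < n \<Longrightarrow> (\<Sum>l<n. of_real (e l) * (u l i * conjugate (u l j))) =
      (\<Sum>l<r. x l i * conjugate (x l j)) - (\<Sum>l<s. y l i * conjugate (y l j))"
  shows "card {l. l < n \<and> e l > 0} \<le> r"
proof (rule ccontr)
  define I where "I = {l. l < n \<and> e l > 0}"
  assume "\<not> card {l. l < n \<and> e l > 0} \<le> r"
  then have "r < card I" "finite I" unfolding I_def by auto
  from underdetermined_system[OF this(2,1), of "\<lambda>m l. \<Sum>j<n. conjugate (x m j) * u l j"] obtain c p where
    p: "p \<in> I" "c p \<noteq> 0" and c: "\<And>m. m < r \<Longrightarrow> (\<Sum>l\<in>I. (\<Sum>j<n. conjugate (x m j) * u l j) * c l) = 0" by auto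
  define w where "w j = (\<Sum>l\<in>I. c l * u l j)" for j
  have pair: "(\<Sum>j<n. conjugate (z j) * w j) = (\<Sum>l\<in>I. (\<Sum>j<n. conjugate (z j) * u l j) * c l)" for z :: "nat \<Rightarrow> 'a"
    unfolding w_def sum_distrib_left sum_distrib_right
    by (subst sum.swap) (simp add: mult_ac)
  have wx: "(\<Sum>j<n. conjugate (x m j) * w j) = 0" if "m < r" for m
    unfolding pair by (rule c[OF that])
  have wu: "(\<Sum>j<n. conjugate (u l j) * w j) = (if l \<in> I then c l else 0)" if "l < n" for l
  proof -
    have "(\<Sum>j<n. conjugate (u l j) * w j) = (\<Sum>m\<in>I. if l = m then c m else 0)"
      unfolding pair by (intro sum.cong refl) (use orth that in \<open>auto simp: I_def\<close>)
    then show ?thesis using \<open>finite I\<close> by simp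
  qed
  let ?Q = "\<lambda>F. \<Sum>i<n. \<Sum>j<n. conjugate (w i) * F i j * w j"
  have Q1: "?Q (\<lambda>i j. \<Sum>l<n. of_real (e l) * (u l i * conjugate (u l j)))
    = of_real (\<Sum>l<n. e l * sqnorm (if l \<in> I then c l else 0))"
    unfolding quadratic_form_sum by (intro arg_cong[of _ _ of_real] sum.cong) (auto simp: wu)
  have "?Q (\<lambda>i j. \<Sum>l<n. of_real (e l) * (u l i * conjugate (u l j)))
    = ?Q (\<lambda>i j. (\<Sum>l<r. x l i * conjugate (x l j)) - (\<Sum>l<s. y l i * conjugate (y l j)))"
    by (intro sum.cong refl) (use eq in auto)
  also have "\<dots> = ?Q (\<lambda>i j. \<Sum>l<r. of_real 1 * (x l i * conjugate (x l j))) - ?Q (\<lambda>i j. \<Sum>l<s. of_real 1 * (y l i * conjugate (y l j)))"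
    by (simp add: ring_distribs sum_subtractf)
  also have "\<dots> = of_real (\<Sum>l<r. 1 * sqnorm (\<Sum>j<n. conjugate (x l j) * w j)) - of_real (\<Sum>l<s. 1 * sqnorm (\<Sum>j<n. conjugate (y l j) * w j))"
    by (simp only: quadratic_form_sum)
  also have "(\<Sum>l<r. 1 * sqnorm (\<Sum>j<n. conjugate (x l j) * w j)) = 0"
    by (intro sum.neutral) (auto simp: wx sqnorm_def)
  finally have "of_real (\<Sum>l<n. e l * sqnorm (if l \<in> I then c l else 0)) = 
      (of_real (0 - (\<Sum>l<s. 1 * sqnorm (\<Sum>j<n. conjugate (y l j) * w j))) :: 'a)"
    unfolding Q1 by simp
  then have "(\<Sum>l<n. e l * sqnorm (if l \<in> I then c l else 0)) = 0 - (\<Sum>l<s. 1 * sqnorm (\<Sum>j<n. conjugate (y l j) * w j))"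
    unfolding of_real_eq_iff .
  also have "\<dots> \<le> 0" using sum_nonneg[of "{..<s}" "\<lambda>l. 1 * sqnorm (\<Sum>j<n. conjugate (y l j) * w j)"] 
    by (simp add: sqnorm_nonneg)
  finally have le: "(\<Sum>l<n. e l * sqnorm (if l \<in> I then c l else 0)) \<le> 0" .
  have "0 < (\<Sum>l<n. e l * sqnorm (if l \<in> I then c l else 0))"
  proof (rule sum_pos2[of _ p])
    show "0 < e p * sqnorm (if p \<in> I then c p else 0)" using p sqnorm_pos[of "c p"] by (auto simp: I_def)
    show "0 \<le> e l * sqnorm (if l \<in> I then c l else 0)" for l
      by (auto simp: I_def sqnorm_def)
  qed (use p in \<open>auto simp: I_def\<close>)
  with le show False by simp
qed

lemma inertia_le_signature:
  fixes A :: "'a :: real_or_complex mat"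
  assumes A: "A \<in> carrier_mat n n" "mat_adjoint A = A" and sig: "signature_le A r s"
  shows "num_pos_eigenvalues A \<le> r" "num_neg_eigenvalues A \<le> s"
proof -
  from spectral_theorem[OF A] obtain es u where ed: "eigendecomposition A n es u" by blast
  have len: "length es = n" and cp: "char_poly A = (\<Prod>e\<leftarrow>es. [:- of_real e, 1:])"
    using ed unfolding eigendecomposition_def by auto
  have orth: "\<And>l m. l < n \<Longrightarrow> m < n \<Longrightarrow> (\<Sum>i<n. conjugate (u l i) * u m i) = (if l = m then 1 else 0)"
    using ed unfolding eigendecomposition_def by blast
  have Au: "\<And>i j. i < n \<Longrightarrow> j < n \<Longrightarrow> A $$ (i, j) = (\<Sum>l<n. of_real (es ! l) * (u l i * conjugate (u l j)))"
    using ed unfolding eigendecomposition_def by blast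
  from sig A obtain x y where xy: "\<And>i j. i < n \<Longrightarrow> j < n \<Longrightarrow>
      A $$ (i, j) = (\<Sum>l<r. x l i * conjugate (x l j)) - (\<Sum>l<s. y l i * conjugate (y l j))"
    unfolding signature_le_def by auto
  show "num_pos_eigenvalues A \<le> r"
    unfolding num_eigenvalues_eq_card[OF A(1) cp] len
    by (rule positive_part_le[OF orth]) (auto simp: Au[symmetric] xy)
  have "card {l. l < n \<and> - es ! l > 0} \<le> s"
  proof (rule positive_part_le[OF orth])
    fix i j assume ij: "i < n" "j < n"
    have "(\<Sum>l<n. of_real (- es ! l) * (u l i * conjugate (u l j))) = - A $$ (i, j)"
      unfolding Au[OF ij] by (simp add: sum_negf)
    also have "\<dots> = (\<Sum>l<s. y l i * conjugate (y l j)) - (\<Sum>l<r. x l i * conjugate (x l j))"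
      unfolding xy[OF ij] by simp
    finally show "(\<Sum>l<n. of_real (- es ! l) * (u l i * conjugate (u l j))) = (\<Sum>l<s. y l i * conjugate (y l j)) - (\<Sum>l<r. x l i * conjugate (x l j))" .
  qed auto
  then show "num_neg_eigenvalues A \<le> s"
    unfolding num_eigenvalues_eq_card[OF A(1) cp] len by simp
qed

lemma num_pos_plus_num_neg_le:
  fixes A :: "'a :: real_or_complex mat"
  assumes A: "A \<in> carrier_mat n n" "mat_adjoint A = A"
  shows "num_pos_eigenvalues A + num_neg_eigenvalues A \<le> n"
proof -
  from spectral_theorem[OF A] obtain es u where ed: "eigendecomposition A n es u" by blast
  have len: "length es = n" and cp: "char_poly A = (\<Prod>e\<leftarrow>es. [:- of_real e, 1:])"
    using ed unfolding eigendecomposition_def by auto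
  have "card {l. l < n \<and> es ! l > 0} + card {l. l < n \<and> es ! l < 0} = card ({l. l < n \<and> es ! l > 0} \<union> {l. l < n \<and> es ! l < 0})"
    by (rule card_Un_disjoint[symmetric]) auto
  also have "\<dots> \<le> card {..<n}" by (rule card_mono) auto
  finally show ?thesis unfolding num_eigenvalues_eq_card[OF A(1) cp] len by simp
qed

section \<open>Raising the number of negative eigenvalues\<close>

definition shift_diag :: "real \<Rightarrow> nat \<Rightarrow> 'a :: real_or_complex mat \<Rightarrow> 'a mat" where
  "shift_diag t m A = mat (dim_row A) (dim_col A)
     (\<lambda>(i, j). A $$ (i, j) - (if i = j \<and> i < m then of_real t else 0))"

lemma shift_diag_carrier: "A \<in> carrier_mat n n \<Longrightarrow> shift_diag t m A \<in> carrier_mat n n"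
  by (simp add: shift_diag_def)

lemma shift_diag_index: "A \<in> carrier_mat n n \<Longrightarrow> i < n \<Longrightarrow> j < n \<Longrightarrow>
    shift_diag t m A $$ (i, j) = A $$ (i, j) - (if i = j \<and> i < m then of_real t else 0)"
  by (simp add: shift_diag_def)

lemma shift_diag_hermitian:
  fixes A :: "'a :: real_or_complex mat"
  assumes A: "A \<in> carrier_mat n n" "mat_adjoint A = A"
  shows "mat_adjoint (shift_diag t m A) = shift_diag t m A"
  unfolding hermitian_iff[OF shift_diag_carrier[OF A(1)]]
proof (intro allI impI)
  fix i j assume ij: "i < n" "j < n"
  have "A $$ (i, j) = conjugate (A $$ (j, i))" using A ij hermitian_iff[OF A(1)] by blast
  then show "shift_diag t m A $$ (i, j) = conjugate (shift_diag t m A $$ (j, i))"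
    unfolding shift_diag_index[OF A(1) ij] shift_diag_index[OF A(1) ij(2) ij(1)]
    by (simp add: conjugate_simps)
qed

lemma shift_diag_pattern:
  "has_pattern G A \<Longrightarrow> has_pattern G (shift_diag t m A)"
  by (auto simp: has_pattern_def shift_diag_def)

text \<open>One more diagonal entry is lowered by \<open>t\<close>; this subtracts the square of \<open>sqrt t\<close> times a unit
  vector.\<close>

lemma shift_diag_signature:
  fixes A :: "'a :: real_or_complex mat"
  assumes A: "A \<in> carrier_mat n n" and t: "t \<ge> 0" and sig: "signature_le (shift_diag t m A) r s"
  shows "signature_le (shift_diag t (Suc m) A) r (Suc s)"
proof -
  from sig shift_diag_carrier[OF A, of t m] obtain x y where xy: "\<And>i j. i < n \<Longrightarrow> j < n \<Longrightarrow> shift_diag t m A $$ (i, j) =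
      (\<Sum>l<r. x l i * conjugate (x l j)) - (\<Sum>l<s. y l i * conjugate (y l j))"
    unfolding signature_le_def by auto
  define z where "z l i = (if l = s then if i = m then of_real (sqrt t) else 0 else y l i)" for l i
  have zs: "(\<Sum>l<s. z l i * conjugate (z l j)) = (\<Sum>l<s. y l i * conjugate (y l j))" for i j
    by (intro sum.cong) (auto simp: z_def)
  have tt: "of_real (sqrt t) * of_real (sqrt t) = (of_real t :: 'a)"
    using t by (simp flip: of_real_mult)
  have "shift_diag t (Suc m) A $$ (i, j) = (\<Sum>l<r. x l i * conjugate (x l j)) - (\<Sum>l<Suc s. z l i * conjugate (z l j))"
    if ij: "i < n" "j < n" for i j
  proof -
    have "shift_diag t (Suc m) A $$ (i, j) = shift_diag t m A $$ (i, j) - (if i = j \<and> i = m then of_real t else 0)"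
      unfolding shift_diag_index[OF A ij] by auto
    then show ?thesis unfolding xy[OF ij] sum.lessThan_Suc zs by (simp add: z_def tt)
  qed
  then show ?thesis unfolding signature_le_def
    using shift_diag_carrier[OF A, of t "Suc m"] by auto
qed

lemma eigendecomposition_eigenvalue_iff:
  fixes A :: "'a :: real_or_complex mat"
  assumes A: "A \<in> carrier_mat n n" and ed: "eigendecomposition A n es u"
  shows "eigenvalue A (of_real e) \<longleftrightarrow> e \<in> set es"
proof -
  have "char_poly A = (\<Prod>e\<leftarrow>map of_real es. [:- e, 1:])"
    using ed unfolding eigendecomposition_def by (simp add: o_def)
  then have "eigenvalue A (of_real e) \<longleftrightarrow> (of_real e :: 'a) \<in> set (map of_real es)"
    unfolding eigenvalue_root_char_poly[OF A] by (simp only: poly_prod_linear_eq_0_iff)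
  then show ?thesis by auto
qed

text \<open>Lowering the whole diagonal by \<open>t\<close> lowers every eigenvalue by \<open>t\<close>, and \<open>t\<close> is chosen to exceed
  all eigenvalues of \<open>A\<close>.\<close>

lemma shift_diag_negative:
  fixes A :: "'a :: real_or_complex mat"
  assumes A: "A \<in> carrier_mat n n" "mat_adjoint A = A"
  shows "\<exists>t\<ge>0. num_neg_eigenvalues (shift_diag t n A) = n"
proof -
  from spectral_theorem[OF A] obtain es u where ed: "eigendecomposition A n es u" by blast
  \<comment> \<open>the sum is an upper bound of the spectrum; the summand \<open>1\<close> makes the bound strict\<close>
  define t where "t = (\<Sum>e\<in>set es. \<bar>e\<bar>) + 1"
  have t: "e < t" if "e \<in> set es" for e
    using member_le_sum[of e "set es" "\<lambda>e. \<bar>e\<bar>"] that by (auto simp: t_def)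
  define B where "B = shift_diag t n A"
  have B: "B \<in> carrier_mat n n" "mat_adjoint B = B"
    unfolding B_def using shift_diag_carrier[OF A(1)] shift_diag_hermitian[OF A] by auto
  from spectral_theorem[OF B] obtain es' u' where ed': "eigendecomposition B n es' u'" by blast
  have len: "length es' = n" and cp: "char_poly B = (\<Prod>e\<leftarrow>es'. [:- of_real e, 1:])"
    using ed' unfolding eigendecomposition_def by auto
  have "e < 0" if "e \<in> set es'" for e
  proof -
    have "eigenvalue B (of_real e)" using that eigendecomposition_eigenvalue_iff[OF B(1) ed'] by simp
    then obtain v where v: "v \<in> carrier_vec n" "v \<noteq> 0\<^sub>v n" and Bv: "B *\<^sub>v v = of_real e \<cdot>\<^sub>v v"
      using B unfolding eigenvalue_def eigenvector_def by auto
    have "A *\<^sub>v v = of_real (e + t) \<cdot>\<^sub>v v"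
    proof (rule eq_vecI)
      fix i assume "i < dim_vec (of_real (e + t) \<cdot>\<^sub>v v)"
      then have i: "i < n" using v by simp
      have "(A *\<^sub>v v) $ i = (\<Sum>j<n. A $$ (i, j) * v $ j)"
        using A v i by (simp add: scalar_prod_def atLeast0LessThan)
      also have "\<dots> = (\<Sum>j<n. B $$ (i, j) * v $ j + (if i = j then of_real t * v $ j else 0))"
        by (intro sum.cong refl) (use i in \<open>auto simp: B_def shift_diag_index[OF A(1)] algebra_simps\<close>)
      also have "\<dots> = (B *\<^sub>v v) $ i + of_real t * v $ i"
        using B v i by (simp add: scalar_prod_def atLeast0LessThan sum.distrib)
      also have "\<dots> = (of_real (e + t) \<cdot>\<^sub>v v) $ i" unfolding Bv using i v by (simp add: algebra_simps)
      finally show "(A *\<^sub>v v) $ i = (of_real (e + t) \<cdot>\<^sub>v v) $ i" .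
    qed (use A v in auto)
    then have "eigenvalue A (of_real (e + t))"
      unfolding eigenvalue_def eigenvector_def using A v by auto
    then have "e + t \<in> set es" using eigendecomposition_eigenvalue_iff[OF A(1) ed] by blast
    from t[OF this] show ?thesis by simp
  qed
  then have "{l. l < length es' \<and> es' ! l < 0} = {..<n}" using len by auto
  then have "num_neg_eigenvalues B = n" unfolding num_eigenvalues_eq_card[OF B(1) cp] by simp
  moreover have "t \<ge> 0" unfolding t_def using sum_nonneg[of "set es" "\<lambda>e. \<bar>e\<bar>"] by simp
  ultimately show ?thesis unfolding B_def by blast
qed

definition hermitian_mats :: "nat pair_pre_digraph \<Rightarrow> 'a :: real_or_complex mat set" where
  "hermitian_mats G =
     {A \<in> carrier_mat (card (pverts G)) (card (pverts G)). mat_adjoint A = A \<and> has_pattern G A}"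

text \<open>A discrete intermediate value argument along the path that lowers the diagonal entries one by
  one: the first matrix on the path with at least \<open>j\<close> negative eigenvalues has exactly \<open>j\<close> of
  them.\<close>

lemma raise_num_neg:
  fixes A :: "'a :: real_or_complex mat"
  assumes A: "A \<in> hermitian_mats G" and j: "num_neg_eigenvalues A \<le> j" "j \<le> card (pverts G)"
  shows "\<exists>B \<in> (hermitian_mats G :: 'a mat set). num_neg_eigenvalues B = j \<and> num_pos_eigenvalues B \<le> num_pos_eigenvalues A"
proof -
  define n where "n = card (pverts G)"
  have A': "A \<in> carrier_mat n n" "mat_adjoint A = A" "has_pattern G A"
    using A unfolding hermitian_mats_def n_def by auto
  from shift_diag_negative[OF A'(1,2)] obtain t where t: "t \<ge> 0" "num_neg_eigenvalues (shift_diag t n A) = n" by auto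
  let ?B = "\<lambda>m. shift_diag t m A"
  have B: "?B m \<in> carrier_mat n n" "mat_adjoint (?B m) = ?B m" for m
    using shift_diag_carrier[OF A'(1)] shift_diag_hermitian[OF A'(1,2)] by auto
  have B0: "?B 0 = A" by (rule eq_matI) (auto simp: shift_diag_def)
  have step: "num_pos_eigenvalues (?B (Suc m)) \<le> num_pos_eigenvalues (?B m)"
      "num_neg_eigenvalues (?B (Suc m)) \<le> Suc (num_neg_eigenvalues (?B m))" for m
    using inertia_le_signature[OF B shift_diag_signature[OF A'(1) t(1) signature_le_inertia[OF B]]] by auto
  have pos: "num_pos_eigenvalues (?B m) \<le> num_pos_eigenvalues A" for m
    by (induction m) (use B0 step(1) order_trans in \<open>auto\<close>)
  define m where "m = (LEAST m. j \<le> num_neg_eigenvalues (?B m))"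
  have ge: "j \<le> num_neg_eigenvalues (?B m)"
    unfolding m_def by (rule LeastI[of _ n]) (use t j n_def in auto)
  have "num_neg_eigenvalues (?B m) \<le> j"
  proof (cases m)
    case 0
    then show ?thesis using B0 j by simp
  next
    case (Suc m')
    then have "\<not> j \<le> num_neg_eigenvalues (?B m')" using not_less_Least[of m' "\<lambda>m. j \<le> num_neg_eigenvalues (?B m)"] m_def by simp
    then show ?thesis using step(2)[of m'] Suc by simp
  qed
  with ge have "num_neg_eigenvalues (?B m) = j" by simp
  moreover have "?B m \<in> hermitian_mats G"
    using B shift_diag_pattern[OF A'(3)] unfolding hermitian_mats_def n_def by auto
  ultimately show ?thesis using pos[of m] by (intro bexI[of _ "?B m"]) auto
qed

section \<open>Generic points\<close>

text \<open>A weak form of being a polynomial function of the coordinates and their conjugates: polynomial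
  behaviour along each line, tested at natural numbers only. It suffices for avoiding zeros, and
  natural numbers being fixed by conjugation makes the notion closed under conjugation.\<close>

definition poly_on_lines :: "(('i \<Rightarrow> 'a) \<Rightarrow> 'a :: real_or_complex) \<Rightarrow> bool" where
  "poly_on_lines f \<longleftrightarrow>
     (\<forall>x d. \<exists>p. \<forall>m :: nat. f (\<lambda>i. x i + of_nat m * d i) = poly p (of_nat m))"

lemma poly_on_lines_const: "poly_on_lines (\<lambda>_. c)"
  unfolding poly_on_lines_def by (auto intro!: exI[of _ "[:c:]"])

lemma poly_on_lines_coord: 
  fixes i :: 'i
  shows "poly_on_lines (\<lambda>x. x i :: 'a :: real_or_complex)"
proof -
  have "x i + of_nat m * d i = poly [:x i, d i:] (of_nat m)" for x d :: "'i \<Rightarrow> 'a" and m by simp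
  then show ?thesis unfolding poly_on_lines_def by blast
qed

lemma poly_on_lines_add:
  assumes "poly_on_lines f" "poly_on_lines g"
  shows "poly_on_lines (\<lambda>x. f x + g x)"
  using assms unfolding poly_on_lines_def by (metis poly_add)

lemma poly_on_lines_mult:
  assumes "poly_on_lines f" "poly_on_lines g"
  shows "poly_on_lines (\<lambda>x. f x * g x)"
  using assms unfolding poly_on_lines_def by (metis poly_mult)

lemma poly_on_lines_uminus:
  assumes "poly_on_lines f"
  shows "poly_on_lines (\<lambda>x. - f x)"
  using assms unfolding poly_on_lines_def by (metis poly_minus)

lemma poly_on_lines_sum:
  assumes "\<And>l. l \<in> I \<Longrightarrow> poly_on_lines (f l)"
  shows "poly_on_lines (\<lambda>x. \<Sum>l\<in>I. f l x)"
  using assms by (induction I rule: infinite_finite_induct)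
    (auto intro: poly_on_lines_const poly_on_lines_add)

lemma conjugate_of_nat [simp]: "conjugate (of_nat m :: 'a :: real_or_complex) = of_nat m"
  by (metis conjugate_of_real of_real_of_nat_eq)

lemma poly_on_lines_conjugate:
  fixes f :: "('i \<Rightarrow> 'a :: real_or_complex) \<Rightarrow> 'a"
  assumes "poly_on_lines f"
  shows "poly_on_lines (\<lambda>x. conjugate (f x))"
proof -
  have "\<exists>q. \<forall>m :: nat. conjugate (poly p (of_nat m)) = poly q (of_nat m)" for p :: "'a poly"
  proof (induction p)
    case 0
    show ?case by (rule exI[of _ 0]) simp
  next
    case (pCons a p)
    then obtain q where "\<forall>m :: nat. conjugate (poly p (of_nat m)) = poly q (of_nat m)" by blast
    then show ?case by (intro exI[of _ "pCons (conjugate a) q"]) (simp add: conjugate_simps)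
  qed
  then show ?thesis using assms unfolding poly_on_lines_def by metis
qed

lemmas poly_on_lines_intros = poly_on_lines_const poly_on_lines_coord poly_on_lines_add
  poly_on_lines_mult poly_on_lines_uminus poly_on_lines_sum poly_on_lines_conjugate

text \<open>On the line through a point where all of \<open>F\<close> is nonzero and a point where \<open>g\<close> is nonzero, each
  of these functions is a nonzero polynomial. As these have only finitely many roots, some point
  on the line works for all.\<close>

lemma poly_on_lines_common_nonzero:
  fixes F :: "(('i \<Rightarrow> 'a :: real_or_complex) \<Rightarrow> 'a) set"
  assumes "finite F" "\<And>f. f \<in> F \<Longrightarrow> poly_on_lines f" "\<And>f. f \<in> F \<Longrightarrow> \<exists>x. f x \<noteq> 0"
  shows "\<exists>x. \<forall>f\<in>F. f x \<noteq> 0"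
  using assms
proof (induction F rule: finite_induct)
  case (insert g F)
  then obtain x where x: "\<forall>f\<in>F. f x \<noteq> 0" by auto
  from insert.prems obtain y where y: "g y \<noteq> 0" by blast
  define z where "z m i = x i + of_nat m * (y i - x i)" for m :: nat and i
  have z01: "z 0 = x" "z 1 = y" unfolding z_def by auto
  have fin: "finite {m. f (z m) = 0}" if f: "f \<in> insert g F" for f
  proof -
    have "poly_on_lines f" using insert.prems(1) f by blast
    then obtain p where p: "\<And>m. f (z m) = poly p (of_nat m)"
      unfolding poly_on_lines_def z_def by metis
    have "f (z 0) \<noteq> 0 \<or> f (z 1) \<noteq> 0" using f x y z01 by auto
    then have "p \<noteq> 0" using p by auto
    then have "finite {t. poly p t = 0}" by (rule poly_roots_finite)
    then have "finite (of_nat -` {t. poly p t = 0} :: nat set)"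
      by (rule finite_vimageI) (simp add: inj_on_def)
    then show ?thesis by (simp add: p vimage_def)
  qed
  have "finite (\<Union>f\<in>insert g F. {m. f (z m) = 0})" using fin insert.hyps by blast
  then obtain m where "m \<notin> (\<Union>f\<in>insert g F. {m. f (z m) = 0})"
    using infinite_UNIV_nat ex_new_if_finite by blast
  then show ?case by (intro exI[of _ "z m"]) auto
qed simp

section \<open>A balanced matrix with the same pattern\<close>

lemma sum_lessThan_split_0:
  "k > 0 \<Longrightarrow> (\<Sum>l<k. f l) = f 0 + (\<Sum>l\<in>{1..<k}. f l)" for f :: "nat \<Rightarrow> 'a :: comm_monoid_add"
  by (simp add: sum.atLeast_Suc_lessThan flip: atLeast0LessThan)

text \<open>The factor by which an entry of the Gram matrix is multiplied, where \<open>v\<close> and \<open>w\<close> are the two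
  vectors whose product is that entry.\<close>

definition cross :: "nat \<Rightarrow> (nat \<Rightarrow> 'a :: real_or_complex) \<Rightarrow> (nat \<Rightarrow> 'a) \<Rightarrow> (nat \<Rightarrow> 'a) \<Rightarrow> (nat \<Rightarrow> 'a) \<Rightarrow> 'a" where
  "cross k a b v w = (\<Sum>l<k. a l * v l) * conjugate (\<Sum>l<k. b l * w l) +
     (\<Sum>l<k. b l * v l) * conjugate (\<Sum>l<k. a l * w l)"

text \<open>In the notation of the proof, the left-hand side is the sum over \<open>l < k\<close> of the hyperbolic pairs
  of \<open>p l\<close> and \<open>q l\<close>, where \<open>\<Sum>\<^sub>l a\<^sub>l q\<^sub>l = \<Sum>\<^sub>l b\<^sub>l p\<^sub>l\<close>, both sides being \<open>\<alpha>\<beta>\<close>. As \<open>a\<^sub>0 = 1\<close>,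
  this relation expresses \<open>q 0\<close> by the other vectors, and completing products absorbs the pair
  with index \<open>0\<close> into the remaining \<open>k - 1\<close> pairs. What is left over is a multiple of the square
  of \<open>p 0\<close>, whose coefficient vanishes by the orthogonality of \<open>a\<close> and \<open>b\<close>.\<close>

lemma cross_gram_decomposition:
  fixes a b :: "nat \<Rightarrow> 'a :: real_or_complex" and x :: "nat \<Rightarrow> nat \<Rightarrow> 'a"
  assumes k: "k > 0" and a0: "a 0 = 1" and ab: "(\<Sum>l<k. a l * conjugate (b l)) = 0"
  shows "\<exists>P Q. \<forall>i j. cross k a b (\<lambda>l. x l i) (\<lambda>l. x l j) * (\<Sum>l<k. x l i * conjugate (x l j)) =
    (\<Sum>l\<in>{1..<k}. P l i * conjugate (Q l j) + Q l i * conjugate (P l j))"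
proof -
  define \<alpha> where "\<alpha> i = (\<Sum>l<k. a l * x l i)" for i
  define \<beta> where "\<beta> i = (\<Sum>l<k. b l * x l i)" for i
  define p where "p l i = \<alpha> i * x l i" for l i
  define q where "q l i = \<beta> i * x l i" for l i
  \<comment> \<open>multiples of \<open>p 0\<close> chosen so that the mixed products reproduce \<open>q 0\<close> in the form given by \<open>rel\<close>\<close>
  define P where "P l i = p l i - conjugate (a l) * p 0 i" for l i
  define Q where "Q l i = q l i + conjugate (b l) * p 0 i" for l i
  define d where "d l i = b l * p l i - a l * q l i" for l i
  let ?S = "{1..<k}"
  note split = sum_lessThan_split_0[OF k]
  have "(\<Sum>l<k. a l * q l i) = (\<Sum>l<k. b l * p l i)" for i
  proof -
    have "(\<Sum>l<k. a l * q l i) = \<beta> i * \<alpha> i" unfolding q_def \<alpha>_def by (simp add: sum_distrib_left mult_ac)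
    moreover have "(\<Sum>l<k. b l * p l i) = \<alpha> i * \<beta> i" unfolding p_def \<beta>_def by (simp add: sum_distrib_left mult_ac)
    ultimately show ?thesis by simp
  qed
  then have rel: "(\<Sum>l\<in>?S. d l i) = q 0 i - b 0 * p 0 i" for i
    unfolding d_def by (simp add: split a0 sum_subtractf algebra_simps)
  have ab1: "(\<Sum>l\<in>?S. a l * conjugate (b l)) = - conjugate (b 0)"
    using ab by (simp add: split a0 add_eq_0_iff)
  have ab2: "(\<Sum>l\<in>?S. conjugate (a l) * b l) = - b 0"
    using arg_cong[OF ab1, of conjugate] by (simp add: conjugate_simps)
  have "cross k a b (\<lambda>l. x l i) (\<lambda>l. x l j) * (\<Sum>l<k. x l i * conjugate (x l j)) =
    (\<Sum>l\<in>?S. P l i * conjugate (Q l j) + Q l i * conjugate (P l j))" for i j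
  proof -
    have "cross k a b (\<lambda>l. x l i) (\<lambda>l. x l j) * (\<Sum>l<k. x l i * conjugate (x l j)) =
      (\<alpha> i * conjugate (\<beta> j) + \<beta> i * conjugate (\<alpha> j)) * (\<Sum>l<k. x l i * conjugate (x l j))"
      unfolding cross_def \<alpha>_def \<beta>_def ..
    also have "\<dots> = (\<Sum>l<k. p l i * conjugate (q l j) + q l i * conjugate (p l j))"
      unfolding p_def q_def by (simp add: sum_distrib_left conjugate_dist_mul algebra_simps)
    also have "\<dots> = p 0 i * conjugate (q 0 j) + q 0 i * conjugate (p 0 j) +
        (\<Sum>l\<in>?S. p l i * conjugate (q l j) + q l i * conjugate (p l j))"
      by (rule split)
    finally have lhs: "cross k a b (\<lambda>l. x l i) (\<lambda>l. x l j) * (\<Sum>l<k. x l i * conjugate (x l j)) = \<dots>" .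
    have "(\<Sum>l\<in>?S. P l i * conjugate (Q l j) + Q l i * conjugate (P l j)) =
      (\<Sum>l\<in>?S. (p l i * conjugate (q l j) + q l i * conjugate (p l j))
        + conjugate (p 0 j) * d l i + p 0 i * conjugate (d l j)
        - (p 0 i * conjugate (p 0 j)) * (conjugate (a l) * b l)
        - (p 0 i * conjugate (p 0 j)) * (a l * conjugate (b l)))"
      by (intro sum.cong refl) (simp add: P_def Q_def d_def conjugate_simps algebra_simps)
    also have "\<dots> = (\<Sum>l\<in>?S. p l i * conjugate (q l j) + q l i * conjugate (p l j))
        + conjugate (p 0 j) * (q 0 i - b 0 * p 0 i)
        + p 0 i * conjugate (q 0 j - b 0 * p 0 j)
        - (p 0 i * conjugate (p 0 j)) * (- b 0)
        - (p 0 i * conjugate (p 0 j)) * (- conjugate (b 0))"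
      unfolding rel[symmetric] ab1[symmetric] ab2[symmetric]
      by (simp only: sum.distrib sum_subtractf sum_distrib_left sum_conjugate finite_atLeastLessThan)
    also have "\<dots> = p 0 i * conjugate (q 0 j) + q 0 i * conjugate (p 0 j) +
        (\<Sum>l\<in>?S. p l i * conjugate (q l j) + q l i * conjugate (p l j))"
      by (simp add: conjugate_simps algebra_simps)
    finally show ?thesis using lhs by simp
  qed
  then show ?thesis by blast
qed

text \<open>Polarization: each hyperbolic pair is the difference of the squares of \<open>P + Q/2\<close> and \<open>P - Q/2\<close>.\<close>

lemma hyperbolic_signature:
  fixes A :: "'a :: real_or_complex mat"
  assumes "finite S" and eq: "\<And>i j. i < dim_row A \<Longrightarrow> j < dim_col A \<Longrightarrow>
    A $$ (i, j) = (\<Sum>l\<in>S. P l i * conjugate (Q l j) + Q l i * conjugate (P l j))"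
  shows "signature_le A (card S) (card S)"
proof (rule signature_leI)
  fix i j assume "i < dim_row A" "j < dim_col A"
  have half: "(of_real (1/2) + of_real (1/2) :: 'a) = 1" by (simp flip: of_real_add)
  have "P l i * conjugate (Q l j) + Q l i * conjugate (P l j) =
    (P l i + of_real (1/2) * Q l i) * conjugate (P l j + of_real (1/2) * Q l j) -
    (P l i - of_real (1/2) * Q l i) * conjugate (P l j - of_real (1/2) * Q l j)" for l
  proof -
    have "(P l i + of_real (1/2) * Q l i) * conjugate (P l j + of_real (1/2) * Q l j) -
      (P l i - of_real (1/2) * Q l i) * conjugate (P l j - of_real (1/2) * Q l j) =
      (of_real (1/2) + of_real (1/2)) * (P l i * conjugate (Q l j) + Q l i * conjugate (P l j))"
      by (simp only: conjugate_simps conjugate_of_real) (simp only: algebra_simps)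
    then show ?thesis unfolding half by simp
  qed
  then show "A $$ (i, j) =
    (\<Sum>l\<in>S. (P l i + of_real (1/2) * Q l i) * conjugate (P l j + of_real (1/2) * Q l j)) -
    (\<Sum>l\<in>S. (P l i - of_real (1/2) * Q l i) * conjugate (P l j - of_real (1/2) * Q l j))"
    using eq[OF \<open>i < dim_row A\<close> \<open>j < dim_col A\<close>] by (simp add: sum_subtractf)
qed (use assms in auto)

text \<open>The functions \<open>param_a\<close> and \<open>param_b\<close> parametrize the orthogonal pairs \<open>(a, b)\<close> with \<open>a\<^sub>0 = 1\<close>
  by free coordinates: those of \<open>a\<close> on the left and those of \<open>b\<close> on the right summand, for
  indices \<open>l > 0\<close>. The entry \<open>b\<^sub>0\<close> is forced by orthogonality.\<close>

definition param_a :: "(nat + nat \<Rightarrow> 'a :: real_or_complex) \<Rightarrow> nat \<Rightarrow> 'a" where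
  "param_a z l = (if l = 0 then 1 else z (Inl l))"

definition param_b :: "nat \<Rightarrow> (nat + nat \<Rightarrow> 'a :: real_or_complex) \<Rightarrow> nat \<Rightarrow> 'a" where
  "param_b k z l = (if l = 0 then - (\<Sum>m\<in>{1..<k}. conjugate (z (Inl m)) * z (Inr m)) else z (Inr l))"

lemma param_orthogonal:
  fixes z :: "nat + nat \<Rightarrow> 'a :: real_or_complex"
  assumes "k > 0"
  shows "(\<Sum>l<k. param_a z l * conjugate (param_b k z l)) = 0"
  unfolding sum_lessThan_split_0[OF assms]
  by (simp add: param_a_def param_b_def conjugate_simps)

lemma poly_on_lines_cross:
  "poly_on_lines (\<lambda>z. cross k (param_a z) (param_b k z) v w)"
proof -
  have "poly_on_lines (\<lambda>z. param_a z l)" for l :: nat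
    unfolding param_a_def by (cases "l = 0") (auto intro: poly_on_lines_intros)
  moreover have "poly_on_lines (\<lambda>z. param_b k z l)" for l :: nat
    unfolding param_b_def by (cases "l = 0") (auto intro!: poly_on_lines_intros)
  ultimately show ?thesis
    unfolding cross_def by (intro poly_on_lines_intros)
qed

text \<open>It is enough to let \<open>a\<close> and \<open>b\<close> live on two coordinates \<open>0\<close> and \<open>l\<close>, with free entries \<open>t\<close> and
  \<open>c\<close> at \<open>l\<close>. If the factor vanished for all these choices, then all the products \<open>v\<^sub>l cnj w\<^sub>l\<close>
  would be equal to one number \<open>d\<close> with \<open>d\<^sup>2 = - P\<^sup>2\<close>, where \<open>P = v\<^sub>0 cnj w\<^sub>l\<close>. If \<open>P\<close> is
  nonzero, all scalars turn out to be self-conjugate, hence real, and \<open>d / P\<close> is a real square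
  root of \<open>- 1\<close>. So \<open>P = d = 0\<close>, and the sum of the products vanishes. The argument needs an
  index \<open>l \<noteq> 0\<close>, hence \<open>k > 1\<close>.\<close>

lemma cross_nonzero:
  fixes v w :: "nat \<Rightarrow> 'a :: real_or_complex"
  assumes k: "k \<ge> 2" and vw: "(\<Sum>l<k. v l * conjugate (w l)) \<noteq> 0"
  shows "\<exists>z. cross k (param_a z) (param_b k z) v w \<noteq> 0"
proof (rule ccontr)
  assume "\<not> ?thesis"
  then have zero: "cross k (param_a z) (param_b k z) v w = 0" for z by blast
  define u where "u l = conjugate (w l)" for l
  have single: "(v 0 + t * v l) * (conjugate c * (u l - t * u 0)) +
      c * (v l - conjugate t * v 0) * (u 0 + conjugate t * u l) = 0" if l: "l \<in> {1..<k}" for l t c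
  proof -
    define z where "z = case_sum (\<lambda>m. if m = l then t else 0) (\<lambda>m. if m = l then c else 0 :: 'a)"
    have b0: "param_b k z 0 = - (conjugate t * c)"
    proof -
      have "(\<Sum>m\<in>{1..<k}. conjugate (z (Inl m)) * z (Inr m)) = (\<Sum>m\<in>{1..<k}. if m = l then conjugate t * c else 0)"
        by (intro sum.cong) (auto simp: z_def)
      also have "\<dots> = conjugate t * c" using l by simp
      finally show ?thesis by (simp add: param_b_def)
    qed
    have a: "(\<Sum>m<k. param_a z m * y m) = y 0 + t * y l" for y
    proof -
      have "(\<Sum>m\<in>{1..<k}. param_a z m * y m) = (\<Sum>m\<in>{1..<k}. if m = l then t * y m else 0)"
        by (intro sum.cong) (auto simp: z_def param_a_def)
      also have "\<dots> = t * y l" using l by simp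
      finally show ?thesis using k by (simp add: sum_lessThan_split_0) (simp add: param_a_def)
    qed
    have b: "(\<Sum>m<k. param_b k z m * y m) = - (conjugate t * c) * y 0 + c * y l" for y
    proof -
      have "(\<Sum>m\<in>{1..<k}. param_b k z m * y m) = (\<Sum>m\<in>{1..<k}. if m = l then c * y m else 0)"
        by (intro sum.cong) (auto simp: z_def param_b_def)
      also have "\<dots> = c * y l" using l by simp
      finally show ?thesis using k by (simp add: sum_lessThan_split_0 b0)
    qed
    from zero[of z] show ?thesis unfolding cross_def a b u_def
      by (simp add: conjugate_simps algebra_simps)
  qed
  have main: "v 0 * u 0 = 0 \<and> v l * u l = 0" if l: "l \<in> {1..<k}" for l
  proof -
    \<comment> \<open>the choices \<open>(t, c) = (0, 1)\<close>, \<open>(1, 1)\<close> and \<open>(0, c)\<close> suffice\<close>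
    have PQ: "v l * u 0 = - (v 0 * u l)" using single[OF l, of 0 1]
      by (simp add: eq_neg_iff_add_eq_0 add.commute)
    have "2 * (v l * u l - v 0 * u 0) = 0" using single[OF l, of 1 1] by (simp add: algebra_simps)
    then have d: "v l * u l = v 0 * u 0" by simp
    have sq: "(v 0 * u 0) * (v 0 * u 0) = - ((v 0 * u l) * (v 0 * u l))"
    proof -
      have "(v 0 * u 0) * (v 0 * u 0) = (v 0 * u 0) * (v l * u l)" by (simp only: d)
      also have "\<dots> = (v 0 * u l) * (v l * u 0)" by (simp only: mult_ac)
      finally show ?thesis by (simp add: PQ)
    qed
    have "v 0 * u l = 0"
    proof (rule ccontr)
      assume ne: "v 0 * u l \<noteq> 0"
      have conj: "conjugate c = c" for c :: 'a
      proof -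
        have "v 0 * (conjugate c * u l) + c * (v l * u 0) = 0" using single[OF l, of 0 c] by (simp add: mult_ac)
        then have "(conjugate c - c) * (v 0 * u l) = 0" unfolding PQ by (simp add: algebra_simps)
        with ne show ?thesis by simp
      qed
      define s where "s = (v 0 * u 0) / (v 0 * u l)"
      have "s * s = - 1" unfolding s_def times_divide_times_eq sq using ne by simp
      moreover obtain r where "s = of_real r" using conj[of s] conjugate_fixed_iff by blast
      ultimately have "of_real (r * r) = (of_real (- 1) :: 'a)" by simp
      then have "r * r = - 1" unfolding of_real_eq_iff .
      then show False using zero_le_square[of r] by linarith
    qed
    with sq have "v 0 * u 0 = 0" by simp
    with d show ?thesis by simp
  qed
  have "(\<Sum>l<k. v l * u l) = 0"
  proof (rule sum.neutral, rule ballI)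
    fix l assume "l \<in> {..<k}"
    then show "v l * u l = 0" using main[of 1] main[of l] k by (cases "l = 0") auto
  qed
  with vw show False unfolding u_def by simp
qed

text \<open>For a generic orthogonal pair \<open>a\<close>, \<open>b\<close> the multipliers \<open>c i j z\<close> are nonzero wherever \<open>A\<close> is
  nonzero, so that \<open>B\<close> has the pattern of \<open>A\<close>, while the \<open>k - 1\<close> hyperbolic pairs bound its
  inertia.\<close>

lemma smaller_balanced_inertia:
  fixes A :: "'a :: real_or_complex mat"
  assumes A: "A \<in> hermitian_mats G" and inertia: "num_pos_eigenvalues A = k" "num_neg_eigenvalues A = 0"
    and k: "k \<ge> 2"
  shows "\<exists>B \<in> (hermitian_mats G :: 'a mat set). num_pos_eigenvalues B \<le> k - 1 \<and> num_neg_eigenvalues B \<le> k - 1"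
proof -
  define n where "n = card (pverts G)"
  have A': "A \<in> carrier_mat n n" "mat_adjoint A = A" "has_pattern G A"
    using A unfolding hermitian_mats_def n_def by auto
  have "signature_le A k 0" using signature_le_inertia[OF A'(1,2)] inertia by simp
  then obtain x y where "\<forall>i<dim_row A. \<forall>j<dim_col A. A $$ (i, j) =
      (\<Sum>l<k. x l i * conjugate (x l j)) - (\<Sum>l<(0::nat). y l i * conjugate (y l j))"
    unfolding signature_le_def by blast
  then have x: "\<And>i j. i < n \<Longrightarrow> j < n \<Longrightarrow> A $$ (i, j) = (\<Sum>l<k. x l i * conjugate (x l j))"
    using A'(1) by simp
  define c where "c i j z = cross k (param_a z) (param_b k z) (\<lambda>l. x l i) (\<lambda>l. x l j)" for i j z
  define F where "F = (\<lambda>(i, j). c i j) ` {p \<in> {..<n} \<times> {..<n}. A $$ p \<noteq> 0}"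
  have "\<exists>z. \<forall>f\<in>F. f z \<noteq> 0"
  proof (rule poly_on_lines_common_nonzero)
    show "finite F" unfolding F_def by simp
  next
    fix f assume "f \<in> F"
    then show "poly_on_lines f" unfolding F_def c_def using poly_on_lines_cross by auto
  next
    fix f assume "f \<in> F"
    then obtain i j where ij: "i < n" "j < n" "A $$ (i, j) \<noteq> 0" and f: "f = c i j" unfolding F_def by auto
    show "\<exists>z. f z \<noteq> 0" unfolding f c_def by (rule cross_nonzero[OF k]) (use ij x in auto)
  qed
  then obtain z where z: "\<And>i j. i < n \<Longrightarrow> j < n \<Longrightarrow> A $$ (i, j) \<noteq> 0 \<Longrightarrow> c i j z \<noteq> 0" unfolding F_def by fastforce
  define B where "B = mat n n (\<lambda>(i, j). c i j z * A $$ (i, j))"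
  have B: "B \<in> carrier_mat n n" unfolding B_def by simp
  have cc: "conjugate (c j i z) = c i j z" for i j
    unfolding c_def cross_def by (simp add: conjugate_dist_add conjugate_dist_mul mult.commute add.commute)
  have hB: "mat_adjoint B = B"
    unfolding hermitian_iff[OF B]
  proof (intro allI impI)
    fix i j assume ij: "i < n" "j < n"
    then have "A $$ (i, j) = conjugate (A $$ (j, i))" using A' hermitian_iff[OF A'(1)] by blast
    then show "B $$ (i, j) = conjugate (B $$ (j, i))" using ij unfolding B_def by (simp add: conjugate_dist_mul cc)
  qed
  have pB: "has_pattern G B"
    using A'(1,3) z unfolding has_pattern_def B_def by auto
  have k0: "k > 0" using k by simp
  have param_a0: "param_a z 0 = 1" for z :: "nat + nat \<Rightarrow> 'a" by (simp add: param_a_def)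
  obtain P Q where PQ: "\<And>i j. c i j z * (\<Sum>l<k. x l i * conjugate (x l j)) =
      (\<Sum>l\<in>{1..<k}. P l i * conjugate (Q l j) + Q l i * conjugate (P l j))"
    using cross_gram_decomposition[OF k0 param_a0 param_orthogonal[OF k0], of z x] unfolding c_def
    by blast
  have "signature_le B (card {1..<k}) (card {1..<k})"
    by (rule hyperbolic_signature[of _ _ P Q]) (auto simp: B_def x PQ)
  then have "num_pos_eigenvalues B \<le> k - 1" "num_neg_eigenvalues B \<le> k - 1"
    using inertia_le_signature[OF B hB] by auto
  moreover have "B \<in> hermitian_mats G" unfolding hermitian_mats_def using B hB pB n_def by auto
  ultimately show ?thesis by blast
qed

section \<open>Excluding the square partition\<close>

lemma uminus_hermitian_mats:
  fixes A :: "'a :: real_or_complex mat"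
  assumes A: "A \<in> hermitian_mats G"
  shows "- A \<in> hermitian_mats G" "num_neg_eigenvalues (- A) \<le> num_pos_eigenvalues A"
proof -
  define n where "n = card (pverts G)"
  have A': "A \<in> carrier_mat n n" "mat_adjoint A = A" "has_pattern G A"
    using A unfolding hermitian_mats_def n_def by auto
  have m: "- A \<in> carrier_mat n n" using A'(1) by simp
  have h: "mat_adjoint (- A) = - A"
    unfolding hermitian_iff[OF m]
  proof (intro allI impI)
    fix i j assume ij: "i < n" "j < n"
    then have "A $$ (i, j) = conjugate (A $$ (j, i))" using A' hermitian_iff[OF A'(1)] by blast
    then show "(- A) $$ (i, j) = conjugate ((- A) $$ (j, i))" using ij A'(1) by (simp add: conjugate_neg)
  qed
  show "- A \<in> hermitian_mats G"
    using A' m h unfolding hermitian_mats_def n_def has_pattern_def by auto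
  obtain x y where xy: "\<And>i j. i < n \<Longrightarrow> j < n \<Longrightarrow> A $$ (i, j) =
      (\<Sum>l<num_pos_eigenvalues A. x l i * conjugate (x l j)) - (\<Sum>l<num_neg_eigenvalues A. y l i * conjugate (y l j))"
    using signature_le_inertia[OF A'(1,2)] A'(1) unfolding signature_le_def by auto
  have "signature_le (- A) (num_neg_eigenvalues A) (num_pos_eigenvalues A)"
    unfolding signature_le_def
    by (rule exI[of _ y], rule exI[of _ x]) (use A'(1) xy in auto)
  from inertia_le_signature(2)[OF m h this] show "num_neg_eigenvalues (- A) \<le> num_pos_eigenvalues A" .
qed

text \<open>This makes the minimum that defines the first part of the partition a minimum of a nonempty set.
  The matrix is obtained from the adjacency matrix by making all eigenvalues negative and
  changing the sign.\<close>

lemma exists_positive_semidefinite: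
  assumes G: "pair_graph G"
  shows "\<exists>A \<in> (hermitian_mats G :: 'a :: real_or_complex mat set). num_neg_eigenvalues A = 0"
proof -
  define n where "n = card (pverts G)"
  define A where "A = mat n n (\<lambda>(i, j). if (i, j) \<in> parcs G then 1 else 0 :: 'a)"
  have A: "A \<in> carrier_mat n n" unfolding A_def by simp
  interpret pair_graph G by fact
  have sym: "(i, j) \<in> parcs G \<longleftrightarrow> (j, i) \<in> parcs G" for i j
    using arcs_symmetric by blast
  have "mat_adjoint A = A" unfolding hermitian_iff[OF A] using sym by (auto simp: A_def)
  then have "A \<in> hermitian_mats G" using A unfolding hermitian_mats_def n_def has_pattern_def A_def by auto
  moreover from this have "num_neg_eigenvalues A \<le> n"
    using num_pos_plus_num_neg_le[of A n] unfolding hermitian_mats_def n_def by auto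
  ultimately obtain B where B: "B \<in> (hermitian_mats G :: 'a mat set)" "num_neg_eigenvalues B = n"
    using raise_num_neg[of A G n] n_def by auto
  then have "num_pos_eigenvalues B = 0"
    using num_pos_plus_num_neg_le[of B n] unfolding hermitian_mats_def n_def by auto
  with uminus_hermitian_mats[OF B(1)] show ?thesis by (intro bexI[of _ "- B"]) auto
qed

text \<open>The matrix attaining the minimum for \<open>0\<close> negative eigenvalues is traded for a balanced one, and
  the latter is moved to exactly \<open>k - 1\<close> negative eigenvalues.\<close>

lemma last_part_smaller:
  fixes I :: "(nat \<times> nat) set"
  assumes G: "pair_graph G" and k: "k > 1"
    and I: "I = partial_inertia ` (hermitian_mats G :: 'a :: real_or_complex mat set)"
    and min0: "(LEAST r. (r, 0) \<in> I) = k"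
  shows "(LEAST r. (r, k - 1) \<in> I) < k"
proof -
  obtain A0 :: "'a mat" where "A0 \<in> hermitian_mats G" "num_neg_eigenvalues A0 = 0"
    using exists_positive_semidefinite[OF G] by blast
  then have "(num_pos_eigenvalues A0, 0) \<in> I" unfolding I partial_inertia_def by force
  then have "(k, 0) \<in> I" using LeastI[of "\<lambda>r. (r, 0) \<in> I"] min0 by blast
  then obtain A :: "'a mat" where A: "A \<in> hermitian_mats G" "num_pos_eigenvalues A = k" "num_neg_eigenvalues A = 0"
    unfolding I partial_inertia_def by auto
  have kn: "k \<le> card (pverts G)"
    using A num_pos_plus_num_neg_le[of A] unfolding hermitian_mats_def by auto
  from smaller_balanced_inertia[OF A] k obtain B :: "'a mat" where
    B: "B \<in> hermitian_mats G" "num_pos_eigenvalues B \<le> k - 1" "num_neg_eigenvalues B \<le> k - 1" by auto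
  from raise_num_neg[OF B(1,3)] kn obtain C :: "'a mat" where
    C: "C \<in> hermitian_mats G" "num_neg_eigenvalues C = k - 1" "num_pos_eigenvalues C \<le> k - 1"
    using B(2) by fastforce
  then have "(num_pos_eigenvalues C, k - 1) \<in> I" unfolding I partial_inertia_def by force
  then have "(LEAST r. (r, k - 1) \<in> I) \<le> num_pos_eigenvalues C" by (rule Least_le)
  with C(3) k show ?thesis by linarith
qed

lemma square_list_ends:
  assumes "map f [0..<f 0] = replicate k k" "k > (0 :: nat)"
  shows "f 0 = k" "f (k - 1) = k"
proof -
  show f0: "f 0 = k" using arg_cong[OF assms(1), of length] by simp
  have "map f [0..<f 0] ! (k - 1) = replicate k k ! (k - 1)" by (simp only: assms(1))
  then show "f (k - 1) = k" using assms(2) f0 by simp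
qed

theorem corollary7p2:
  fixes G :: "nat pair_pre_digraph" and n k :: nat
  assumes "pair_graph G" and "pverts G = {0..<n}" and "k > 1"
  shows "inertial_partition G \<noteq> replicate k k \<and> herm_inertial_partition G \<noteq> replicate k k"
proof (intro conjI notI)
  assume "inertial_partition G = replicate k k"
  from square_list_ends[OF this[unfolded inertial_partition_def]] assms(3)
  have m: "min_pos G 0 = k" "min_pos G (k - 1) = k" by auto
  have "mat_adjoint A = transpose_mat A" for A :: "real mat"
    by (rule eq_matI) auto
  then have "inertia_set G = partial_inertia ` (hermitian_mats G :: real mat set)"
    unfolding inertia_set_def sym_mats_def hermitian_mats_def by simp
  from last_part_smaller[OF assms(1,3) this] m show False unfolding min_pos_def by simp
next
  assume "herm_inertial_partition G = replicate k k"
  from square_list_ends[OF this[unfolded herm_inertial_partition_def]] assms(3)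
  have m: "herm_min_pos G 0 = k" "herm_min_pos G (k - 1) = k" by auto
  have "herm_inertia_set G = partial_inertia ` (hermitian_mats G :: complex mat set)"
    unfolding herm_inertia_set_def herm_mats_def hermitian_mats_def by simp
  from last_part_smaller[OF assms(1,3) this] m show False unfolding herm_min_pos_def by simp
qed

end
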